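(* Consider the Laplace equation in $d$ dimensions with pure Neumann boundary conditions, discretized with linear finite elements on a uniform mesh, with $N=\Theta(\epsilon^{-d})$ degrees of freedom. Then any quantum-inspired classical algorithm that solves the resulting discrete linear system $A\bm{u}=\bm{f}$ (with $A=h^{d-2}G^TG$, $\bm{f}=h^{d-2}G^TB^T\bm{b}$, equivalently the least-squares problem $\min_{\bm{u}\in\mathbb{R}^N}\frac12\|BG\bm{u}-\bm{b}\|^2$, where $B,G,\bm{b}$ are defined in the context) must, in the worst case over these systems, make at least $$\Omega\left(\frac{\epsilon^{-2d}}{d\log(\epsilon^{-1})}\right)$$ calls to $SQ(BG)$ and $SQ(\bm{b})$.
   Context: Sampling and query access. $Q(\bm{v})$ for $\bm{v}\in\mathbb{C}^n$: one can query any entry of $\bm{v}$. $SQ(\bm{v})$: one can query entries of $\bm{v}$, obtain independent samples of indices $i\in[n]$ with $\Pr(i)=|\bm{v}(i)|^2/\|\bm{v}\|^2$, and query $\|\bm{v}\|$. $SQ(M)$ for a matrix $M\in\mathbb{C}^{m\times n}$: one has $SQ(M(i,:))$ for every row $i\in[m]$ and $SQ(\mathbf{a})$ for $\mathbf{a}=(\|M(1,:)\|,\dots,\|M(m,:)\|)$. A quantum-inspired classical algorithm is a randomized classical algorithm accessing its input only through such sampling and query access; its complexity is the number of accesses. To solve the system means to be able to sample from the distribution on $\{1,\dots,N\}$ defined by the solution $\bm{u}^*$ below, $\Pr(i)=|\bm{u}^*(i)|^2/\|\bm{u}^*\|^2$. Discrete system and construction. The mesh is uniform of size $h=\Theta(\epsilon)$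 (so $N=\Theta(h^{-d})=\Theta(\epsilon^{-d})$). The sparsity pattern of the discrete Laplacian is a graph with $N$ nodes (the mesh vertices) and $M$ edges (the nonzero off-diagonal couplings), of maximal degree $\delta_{\max}=\Theta(d)$. $G\in\mathbb{R}^{M\times N}$ is the discrete gradient, i.e. the (signed) edge-node incidence matrix of this graph, and $A=h^{d-2}G^TG$ is the stiffness matrix. Let $\{v_1,\dots,v_k\}$ be an independent set of the graph, labelled as the first $k$ nodes, $k$ being the size of the largest one (one may choose $k$ as large as possible); $\delta_j$ is the degree of $v_j$, and $\widetilde{\bm{g}}_j\in\mathbb{R}^{\delta_j}$ is the vector of nonzero components of $\bm{g}_j=G\bm{e}^N_j$. Order the edges so that those incident to $v_1$ come first, then those incident to $v_2$, ..., then those incident to $v_k$, then the remaining edges. Let $n\ge 3200k$ and let $T_1,\dots,T_k\in\{0,1\}^n$ be bit strings of Hamming weight $\Theta(n)$, $\bm{t}_j=\sum_\ell T_{j\ell}\bm{e}^n_\ell$, $\overline{\bm{t}}_j=\bm{t}_j/\|\bm{t}_j\|$, where $\bm{e}^n_\ell$ is the $\ell$-th unit vector of $\mathbb{R}^n$. Define $$B=\mathrm{diag}\left(I_{(\delta_1)}\otimes\bm{e}^n_1,\ I_{(\delta_2)}\otimes\overline{\bm{t}}_2,\dots,I_{(\delta_k)}\otimes\overline{\bm{t}}_k,\ \tfrac{1}{\sqrt n}I_{(M-\sum_{j=1}^k\delta_j)}\otimes\bm{1}\right)\in\mathbb{R}^{Mn\times M},$$ where $\bm{1}\in\mathbb{R}^n$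 is the all-ones vector (so $B^TB=I$), and $$\bm{b}=\begin{pmatrix}\widetilde{\bm{g}}_1\otimes\bm{e}^n_1\\ n\,\widetilde{\bm{g}}_2\otimes\overline{\bm{t}}_1\\ \vdots\\ n\,\widetilde{\bm{g}}_k\otimes\overline{\bm{t}}_1\\ \bm{0}\end{pmatrix}\in\mathbb{R}^{Mn}.$$ The solution considered is $\bm{u}^*=\bm{e}^N_1+n\sum_{j=2}^k(\overline{\bm{t}}_1^T\overline{\bm{t}}_j)\,\bm{e}^N_j\in\mathbb{R}^N$. *)

theory Defs
  imports
    "HOL-Probability.Probability_Mass_Function"
    "Jordan_Normal_Form.Matrix"
    "HOL-Combinatorics.Permutations"
begin

hide_type (open) Finite_Cartesian_Product.vec
hide_const (open) Finite_Cartesian_Product.vec Finite_Cartesian_Product.row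
  Finite_Cartesian_Product.mat Inner_Product.real_inner_class.inner
no_notation Finite_Cartesian_Product.vec_nth (infixl \<open>$\<close> 90)
no_notation Inner_Product.real_inner_class.inner (infix \<open>\<bullet>\<close> 70)

text \<open>All indices (nodes, edges, rows, columns, bit strings, samples) are 0-based, so the objects
  numbered 1, ..., k in the mathematics are numbered 0, ..., k - 1 here.\<close>

section \<open>Vectors and matrices\<close>

definition l2_norm :: "real vec \<Rightarrow> real" where
  "l2_norm v = sqrt (v \<bullet> v)"

definition kron_vec :: "real vec \<Rightarrow> real vec \<Rightarrow> real vec" (infixr \<open>\<otimes>\<^sub>v\<close> 75) where
  "v \<otimes>\<^sub>v w = vec (dim_vec v * dim_vec w) (\<lambda>i. v $ (i div dim_vec w) * w $ (i mod dim_vec w))"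

definition kron_mat :: "real mat \<Rightarrow> real mat \<Rightarrow> real mat" (infixr \<open>\<otimes>\<^sub>m\<close> 75) where
  "P \<otimes>\<^sub>m Q = mat (dim_row P * dim_row Q) (dim_col P * dim_col Q)
     (\<lambda>(i, j). P $$ (i div dim_row Q, j div dim_col Q) * Q $$ (i mod dim_row Q, j mod dim_col Q))"

abbreviation column_mat :: "real vec \<Rightarrow> real mat" where
  "column_mat v \<equiv> mat_of_cols (dim_vec v) [v]"

abbreviation ones :: "nat \<Rightarrow> real vec" where
  "ones n \<equiv> vec n (\<lambda>_. 1)"

section \<open>Sampling and query access\<close>

datatype sq_call = Entry nat | Sample | Norm

datatype answer = Value real | Index nat | Undefined

text \<open>The distribution with probability \<open>v(i)\<^sup>2 / \<parallel>v\<parallel>\<^sup>2\<close> at \<open>i\<close>; meaningful for \<open>v \<noteq> 0\<close> only.\<close>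

definition l2_pmf :: "real vec \<Rightarrow> nat pmf" where
  "l2_pmf v = embed_pmf (\<lambda>i. if i < dim_vec v then (v $ i)\<^sup>2 / (l2_norm v)\<^sup>2 else 0)"

text \<open>Calls without a mathematical meaning (an index out of range, sampling from the zero vector)
  are answered by \<open>Undefined\<close>. This matters: most rows of the matrix accessed below can vanish.\<close>

fun sq_answer :: "real vec \<Rightarrow> sq_call \<Rightarrow> answer pmf" where
  "sq_answer v (Entry i) = return_pmf (if i < dim_vec v then Value (v $ i) else Undefined)"
| "sq_answer v Sample =
     (if v = 0\<^sub>v (dim_vec v) then return_pmf Undefined else map_pmf Index (l2_pmf v))"
| "sq_answer v Norm = return_pmf (Value (l2_norm v))"

definition row_norms :: "real mat \<Rightarrow> real vec" where
  "row_norms P = vec (dim_row P) (\<lambda>i. l2_norm (row P i))"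

text \<open>A call to \<open>SQ(P)\<close> is an \<open>SQ\<close> call to a row of \<open>P\<close> or to the vector of its row norms; the last
  kind of call goes to \<open>SQ(b)\<close>.\<close>

datatype access = Row nat sq_call | Row_Norms sq_call | Rhs sq_call

fun answer_access :: "real mat \<Rightarrow> real vec \<Rightarrow> access \<Rightarrow> answer pmf" where
  "answer_access P b (Row i q) = (if i < dim_row P then sq_answer (row P i) q else return_pmf Undefined)"
| "answer_access P b (Row_Norms q) = sq_answer (row_norms P) q"
| "answer_access P b (Rhs q) = sq_answer b q"

text \<open>A randomized algorithm is a possibly infinite tree. In each move it tosses coins and then
  either returns an index or makes one call and continues depending on the answer. Everything
  other than the calls is free, and the tree may depend on anything but the vector and matrix accessed.\<close>

codatatype algorithm = Algorithm (move: "(nat + access \<times> (answer \<Rightarrow> algorithm)) pmf")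

text \<open>The output if the algorithm returns within the first \<open>t\<close> moves, and \<open>None\<close> otherwise.\<close>

primrec run :: "(access \<Rightarrow> answer pmf) \<Rightarrow> nat \<Rightarrow> algorithm \<Rightarrow> nat option pmf" where
  "run orc 0 alg = return_pmf None"
| "run orc (Suc t) alg = bind_pmf (move alg) (\<lambda>m. case m of
       Inl i \<Rightarrow> return_pmf (Some i)
     | Inr (q, continue) \<Rightarrow> bind_pmf (orc q) (\<lambda>r. run orc t (continue r)))"

definition samples_from :: "(access \<Rightarrow> answer pmf) \<Rightarrow> algorithm \<Rightarrow> nat pmf \<Rightarrow> bool" where
  "samples_from orc alg p \<longleftrightarrow> (\<forall>i. (\<lambda>t. pmf (run orc t alg) (Some i)) \<longlonglongrightarrow> pmf p i)"

text \<open>The expected number of calls, as the sum over \<open>t\<close> of the probability of making more than \<open>t\<close>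
  calls, that is, of not returning within the first \<open>t + 1\<close> moves.\<close>

definition expected_calls :: "(access \<Rightarrow> answer pmf) \<Rightarrow> algorithm \<Rightarrow> ennreal" where
  "expected_calls orc alg = (\<Sum>t. ennreal (pmf (run orc (Suc t) alg) None))"

section \<open>Linear finite elements on a uniform mesh\<close>

text \<open>The domain is a union of cubes \<open>h (c + [0, 1]\<^sup>d)\<close>, where \<open>c\<close> ranges over a finite set of lattice
  points; it need not be connected. Each cube is divided into the \<open>d!\<close> Kuhn simplices, one for each permutation \<open>\<sigma>\<close> of
  the coordinates: the vertices of the simplex, in units of \<open>h\<close>, are \<open>c\<close>, \<open>c + e\<^bsub>\<sigma>(0)\<^esub>\<close>,
  \<open>c + e\<^bsub>\<sigma>(0)\<^esub> + e\<^bsub>\<sigma>(1)\<^esub>\<close>, and so on.\<close>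

definition kuhn_vertex :: "int vec \<Rightarrow> (nat \<Rightarrow> nat) \<Rightarrow> nat \<Rightarrow> int vec" where
  "kuhn_vertex c \<sigma> i = vec (dim_vec c) (\<lambda>r. c $ r + of_bool (r \<in> \<sigma> ` {..<i}))"

definition mesh_vertices :: "nat \<Rightarrow> int vec set \<Rightarrow> int vec set" where
  "mesh_vertices d C = {kuhn_vertex c \<sigma> i | c \<sigma> i. c \<in> C \<and> \<sigma> permutes {..<d} \<and> i \<le> d}"

text \<open>The constant gradient, on the simplex \<open>(c, \<sigma>)\<close>, of the continuous piecewise linear function
  that is 1 at the mesh vertex \<open>v\<close> and 0 at all other mesh vertices.\<close>

definition hat_gradient :: "nat \<Rightarrow> real \<Rightarrow> int vec \<Rightarrow> (nat \<Rightarrow> nat) \<Rightarrow> int vec \<Rightarrow> real vec" where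
  "hat_gradient d h c \<sigma> v = (THE g. g \<in> carrier_vec d \<and>
     (\<forall>i\<le>d. g \<bullet> (h \<cdot>\<^sub>v map_vec real_of_int (kuhn_vertex c \<sigma> i - c)) =
        of_bool (kuhn_vertex c \<sigma> i = v) - of_bool (c = v)))"

text \<open>The integral of \<open>\<nabla>\<phi>\<^sub>v \<bullet> \<nabla>\<phi>\<^sub>w\<close> over the domain, simplex by simplex. The boundary
  condition is pure Neumann: every mesh vertex, on the boundary or not, carries a degree of
  freedom.\<close>

definition laplace_coupling :: "nat \<Rightarrow> real \<Rightarrow> int vec set \<Rightarrow> int vec \<Rightarrow> int vec \<Rightarrow> real" where
  "laplace_coupling d h C v w = (\<Sum>c\<in>C. \<Sum>\<sigma> | \<sigma> permutes {..<d}.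
     h ^ d / fact d * (hat_gradient d h c \<sigma> v \<bullet> hat_gradient d h c \<sigma> w))"

text \<open>A discretization comes with a numbering of the nodes and with a list of the edges of the
  sparsity graph, each edge given an arbitrary orientation (tail, head).\<close>

record discretization =
  space_dim :: nat
  mesh_size :: real
  cells :: "int vec set"
  node :: "nat \<Rightarrow> int vec"
  edges :: "(nat \<times> nat) list"
  indep_size :: nat

definition num_nodes :: "discretization \<Rightarrow> nat" where
  "num_nodes D = card (mesh_vertices (space_dim D) (cells D))"

definition num_edges :: "discretization \<Rightarrow> nat" where
  "num_edges D = length (edges D)"

definition adjacent :: "discretization \<Rightarrow> nat \<Rightarrow> nat \<Rightarrow> bool" where
  "adjacent D i j \<longleftrightarrow> i \<noteq> j \<and>
     laplace_coupling (space_dim D) (mesh_size D) (cells D) (node D i) (node D j) \<noteq> 0"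

definition independent_set :: "discretization \<Rightarrow> nat set \<Rightarrow> bool" where
  "independent_set D S \<longleftrightarrow> S \<subseteq> {..<num_nodes D} \<and> (\<forall>i\<in>S. \<forall>j\<in>S. \<not> adjacent D i j)"

text \<open>The nodes \<open>0, ..., indep_size D - 1\<close> form a maximum independent set. An edge has at most one
  endpoint \<open>j\<close> among them; its sorting key below is \<open>j\<close> if there is one and \<open>indep_size D\<close>
  otherwise, so the edges at node 0 come first, then those at node 1, etc.\<close>

definition valid_discretization :: "discretization \<Rightarrow> bool" where
  "valid_discretization D \<longleftrightarrow>
     space_dim D \<ge> 1 \<and> mesh_size D > 0 \<and>
     finite (cells D) \<and> cells D \<noteq> {} \<and> cells D \<subseteq> carrier_vec (space_dim D) \<and>
     bij_betw (node D) {..<num_nodes D} (mesh_vertices (space_dim D) (cells D)) \<and>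
     distinct (map (\<lambda>(i, j). {i, j}) (edges D)) \<and>
     set (map (\<lambda>(i, j). {i, j}) (edges D)) =
       {{i, j} | i j. i < num_nodes D \<and> j < num_nodes D \<and> adjacent D i j} \<and>
     independent_set D {..<indep_size D} \<and>
     (\<forall>S. independent_set D S \<longrightarrow> card S \<le> indep_size D) \<and>
     sorted (map (\<lambda>(i, j). min (indep_size D) (min i j)) (edges D))"

definition degree :: "discretization \<Rightarrow> nat \<Rightarrow> nat" where
  "degree D j = length (filter (\<lambda>(i, i'). i = j \<or> i' = j) (edges D))"

section \<open>The linear systems\<close>

definition grad_mat :: "discretization \<Rightarrow> real mat" where
  "grad_mat D = mat (num_edges D) (num_nodes D)
     (\<lambda>(e, j). of_bool (snd (edges D ! e) = j) - of_bool (fst (edges D ! e) = j))"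

definition nonzero_part :: "real vec \<Rightarrow> real vec" where
  "nonzero_part v = vec_of_list (filter (\<lambda>x. x \<noteq> 0) (list_of_vec v))"

definition g_tilde :: "discretization \<Rightarrow> nat \<Rightarrow> real vec" where
  "g_tilde D j = nonzero_part (col (grad_mat D) j)"

text \<open>\<open>T j l\<close> is the \<open>l\<close>-th bit of the \<open>j\<close>-th bit string.\<close>

definition hamming_weight :: "nat \<Rightarrow> (nat \<Rightarrow> bool) \<Rightarrow> nat" where
  "hamming_weight n s = card {l. l < n \<and> s l}"

definition t_vec :: "nat \<Rightarrow> (nat \<Rightarrow> bool) \<Rightarrow> real vec" where
  "t_vec n s = vec n (\<lambda>l. of_bool (s l))"

definition t_bar :: "nat \<Rightarrow> (nat \<Rightarrow> bool) \<Rightarrow> real vec" where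
  "t_bar n s = (1 / l2_norm (t_vec n s)) \<cdot>\<^sub>v t_vec n s"

definition B_mat :: "discretization \<Rightarrow> nat \<Rightarrow> (nat \<Rightarrow> nat \<Rightarrow> bool) \<Rightarrow> real mat" where
  "B_mat D n T = diag_block_mat (
     [1\<^sub>m (degree D 0) \<otimes>\<^sub>m column_mat (unit_vec n 0)] @
     map (\<lambda>j. 1\<^sub>m (degree D j) \<otimes>\<^sub>m column_mat (t_bar n (T j))) [1..<indep_size D] @
     [(1 / sqrt (real n)) \<cdot>\<^sub>m
        (1\<^sub>m (num_edges D - (\<Sum>j<indep_size D. degree D j)) \<otimes>\<^sub>m column_mat (ones n))])"

definition b_vec :: "discretization \<Rightarrow> nat \<Rightarrow> (nat \<Rightarrow> nat \<Rightarrow> bool) \<Rightarrow> real vec" where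
  "b_vec D n T = foldr (@\<^sub>v) (
     [g_tilde D 0 \<otimes>\<^sub>v unit_vec n 0] @
     map (\<lambda>j. real n \<cdot>\<^sub>v (g_tilde D j \<otimes>\<^sub>v t_bar n (T 0))) [1..<indep_size D])
     (0\<^sub>v ((num_edges D - (\<Sum>j<indep_size D. degree D j)) * n))"

text \<open>The gradient matrix is the plain incidence matrix. The assembled coupling of two neighbours is
  \<open>-h\<^bsup>d-2\<^esup>\<close> in the interior and smaller in modulus along the boundary; only its being
  nonzero is used.\<close>

definition A_mat :: "discretization \<Rightarrow> real mat" where
  "A_mat D = (mesh_size D powi (int (space_dim D) - 2)) \<cdot>\<^sub>m
     (transpose_mat (grad_mat D) * grad_mat D)"

definition f_vec :: "discretization \<Rightarrow> nat \<Rightarrow> (nat \<Rightarrow> nat \<Rightarrow> bool) \<Rightarrow> real vec" where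
  "f_vec D n T = (mesh_size D powi (int (space_dim D) - 2)) \<cdot>\<^sub>v
     (transpose_mat (grad_mat D) *\<^sub>v (transpose_mat (B_mat D n T) *\<^sub>v b_vec D n T))"

definition BG_mat :: "discretization \<Rightarrow> nat \<Rightarrow> (nat \<Rightarrow> nat \<Rightarrow> bool) \<Rightarrow> real mat" where
  "BG_mat D n T = B_mat D n T * grad_mat D"

definition least_squares_solution ::
  "discretization \<Rightarrow> nat \<Rightarrow> (nat \<Rightarrow> nat \<Rightarrow> bool) \<Rightarrow> real vec \<Rightarrow> bool" where
  "least_squares_solution D n T =
     is_arg_min (\<lambda>u. 1 / 2 * (l2_norm (BG_mat D n T *\<^sub>v u - b_vec D n T))\<^sup>2)
       (\<lambda>u. u \<in> carrier_vec (num_nodes D))"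

text \<open>\<open>A\<close> is singular (its kernel contains the constants), so \<open>A u = f\<close> has many solutions; the
  following one is the one to be sampled from.\<close>

definition u_star :: "discretization \<Rightarrow> nat \<Rightarrow> (nat \<Rightarrow> nat \<Rightarrow> bool) \<Rightarrow> real vec" where
  "u_star D n T = unit_vec (num_nodes D) 0 + real n \<cdot>\<^sub>v vec (num_nodes D)
     (\<lambda>j. if 1 \<le> j \<and> j < indep_size D then t_bar n (T 0) \<bullet> t_bar n (T j) else 0)"

abbreviation system_access ::
  "discretization \<Rightarrow> nat \<Rightarrow> (nat \<Rightarrow> nat \<Rightarrow> bool) \<Rightarrow> access \<Rightarrow> answer pmf" where
  "system_access D n T \<equiv> answer_access (BG_mat D n T) (b_vec D n T)"

definition solves_system ::
  "algorithm \<Rightarrow> discretization \<Rightarrow> nat \<Rightarrow> (nat \<Rightarrow> nat \<Rightarrow> bool) \<Rightarrow> bool" where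
  "solves_system alg D n T \<longleftrightarrow>
     samples_from (system_access D n T) alg (l2_pmf (u_star D n T))"

text \<open>The bit strings of Hamming weight \<open>\<Theta>(n)\<close>, with explicit constants. Two strings of weight above
  \<open>n / 2\<close> always intersect, so a lower bound needs \<open>\<alpha> < 1 / 2\<close>.\<close>

definition admissible_bits ::
  "real \<Rightarrow> real \<Rightarrow> discretization \<Rightarrow> nat \<Rightarrow> (nat \<Rightarrow> nat \<Rightarrow> bool) set" where
  "admissible_bits \<alpha> \<beta> D n = {T. \<forall>j<indep_size D.
     \<alpha> * real n \<le> real (hamming_weight n (T j)) \<and> real (hamming_weight n (T j)) \<le> \<beta> * real n}"

end

(*
Let T_0 be the first w bit positions and every other T_j the next w ones, so that u* = e_0. Planting
a pair (j, l), that is, replacing l + w by l in T_j, makes T_0 and T_j meet and moves at least half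
of the weight of u* to j, so an algorithm that samples correctly must tell the planted instances
from the unplanted one. An entry query to a row reveals the effect of at most one plant, and
sampling from the row norms notices a random plant with probability of order 1 / (number of
plants). By a hybrid argument the expected number of calls on the unplanted instance is thus at
least half of the number (k - 1) w of plants. The graph is bipartite, hence k is at least N / 2,
and w is of order n, which is at least 3200 k. Since the unplanted T_0 can be fixed, no reduction
from communication complexity is needed and the logarithm is not lost.
*)

theory Submission
  imports Defs
begin

section \<open>Advantage per call and expected calls\<close>

text \<open>The hybrid argument needs no budget of calls. Differences of output probabilities are
  summed over all plants before anything is estimated, and one call raises this sum by at most 1,
  even if every plant is tested by a function of its own with values in \<open>[0, 1]\<close>.
  Induction over truncated runs turns this into a bound by the expected number of calls on the
  unplanted side; a limit then removes the truncation. The obstacle is the access that sees many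
  rows at once: the norm of the vector of row norms, and sampling from it. This is why a plant moves
  a bit instead of adding one. All weights stay equal to \<open>w\<close>, no other coordinate of
  \<open>t_bar\<close> is rescaled, the columns of \<open>B_mat\<close> remain unit vectors, and the
  norm in question is sqrt (2 M) for every instance. The right-hand side depends on the bits only
  through the string of node 0, which is never planted. A single shared bit contributes just 1 / w
  to an inner product, but the factor n in \<open>u_star\<close> amplifies it to n / w, which is at
  least 2.\<close>

lemma integrable_pmf_bounded:
  fixes f :: "'a \<Rightarrow> real"
  assumes "\<And>x. \<bar>f x\<bar> \<le> B"
  shows "integrable (measure_pmf p) f"
  by (rule measure_pmf.integrable_const_bound[where B = B]) (use assms in auto)

lemma pmf_run_Suc:
  "pmf (run orc (Suc t) alg) g = measure_pmf.expectation (move alg) (\<lambda>m. case m of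
       Inl i \<Rightarrow> of_bool (g = Some i)
     | Inr (q, continue) \<Rightarrow> measure_pmf.expectation (orc q) (\<lambda>r. pmf (run orc t (continue r)) g))"
  unfolding run.simps pmf_bind
  by (intro Bochner_Integration.integral_cong) (auto simp: pmf_bind indicator_def split: sum.split)

text \<open>By the tail-sum formula this is the expectation of the number of calls capped at
  \<open>t\<close>. Being finite, it can be handled by real integrals, whereas
  \<open>expected_calls\<close> may be infinite.\<close>

definition calls_upto :: "(access \<Rightarrow> answer pmf) \<Rightarrow> nat \<Rightarrow> algorithm \<Rightarrow> real" where
  "calls_upto orc t alg = (\<Sum>s<t. pmf (run orc (Suc s) alg) None)"

lemma calls_upto_bounds: "0 \<le> calls_upto orc t alg" "calls_upto orc t alg \<le> real t"
proof -
  show "0 \<le> calls_upto orc t alg" by (simp add: calls_upto_def sum_nonneg)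
  have "calls_upto orc t alg \<le> (\<Sum>s<t. 1)"
    unfolding calls_upto_def by (intro sum_mono pmf_le_1)
  then show "calls_upto orc t alg \<le> real t" by simp
qed

lemma integrable_calls_upto: "integrable (measure_pmf p) (\<lambda>r. calls_upto orc t (f r))"
  by (rule integrable_pmf_bounded[where B = "real t"]) (simp add: calls_upto_bounds)

lemma integrable_pmf_fun: "integrable (measure_pmf p) (\<lambda>r. pmf (f r) x)"
  by (rule integrable_pmf_bounded[where B = 1]) (simp add: pmf_le_1)

lemma expectation_bounds:
  fixes f :: "'a \<Rightarrow> real"
  assumes "\<And>x. a \<le> f x" "\<And>x. f x \<le> b"
  shows "a \<le> measure_pmf.expectation p f" "measure_pmf.expectation p f \<le> b"
proof -
  have i: "integrable (measure_pmf p) f"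
    by (rule integrable_pmf_bounded[where B = "\<bar>a\<bar> + \<bar>b\<bar>"])
      (use assms in \<open>smt (verit)\<close>)
  show "a \<le> measure_pmf.expectation p f" "measure_pmf.expectation p f \<le> b"
    using i assms by (auto intro: measure_pmf.integral_ge_const measure_pmf.integral_le_const)
qed

text \<open>The summand \<open>s = 0\<close> is the cost of the call itself, since a run with no
  moves left yields \<open>None\<close> surely; the other summands, shifted by one, are the capped
  costs of the continuation.\<close>

lemma calls_upto_Suc:
  "calls_upto orc (Suc t) alg = measure_pmf.expectation (move alg) (\<lambda>m. case m of
       Inl i \<Rightarrow> 0
     | Inr (q, continue) \<Rightarrow>
         1 + measure_pmf.expectation (orc q) (\<lambda>r. calls_upto orc t (continue r)))"
proof -
  have "calls_upto orc (Suc t) alg =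
     (\<Sum>s<Suc t. measure_pmf.expectation (move alg) (\<lambda>m. case m of
       Inl i \<Rightarrow> 0
     | Inr (q, continue) \<Rightarrow> measure_pmf.expectation (orc q) (\<lambda>r. pmf (run orc s (continue r)) None)))"
    unfolding calls_upto_def pmf_run_Suc by simp
  also have "\<dots> = measure_pmf.expectation (move alg) (\<lambda>m. \<Sum>s<Suc t. case m of
       Inl i \<Rightarrow> 0
     | Inr (q, continue) \<Rightarrow> measure_pmf.expectation (orc q) (\<lambda>r. pmf (run orc s (continue r)) None))"
    by (intro Bochner_Integration.integral_sum[symmetric] integrable_pmf_bounded[where B = 1])
      (auto split: sum.split intro!: abs_leI expectation_bounds order_trans[OF _ expectation_bounds(1)[where a=0]] pmf_le_1)
  also have "\<dots> = measure_pmf.expectation (move alg) (\<lambda>m. case m of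
       Inl i \<Rightarrow> 0
     | Inr (q, continue) \<Rightarrow>
         1 + measure_pmf.expectation (orc q) (\<lambda>r. calls_upto orc t (continue r)))"
    by (intro Bochner_Integration.integral_cong)
      (auto split: sum.split simp: sum.lessThan_Suc_shift calls_upto_def integrable_pmf_fun
        Bochner_Integration.integral_sum simp del: run.simps(2) sum.lessThan_Suc)
  finally show ?thesis .
qed

text \<open>Each plant has its own test \<open>f z\<close> in \<open>adv\<close> because, after the
  first call, the test is the success probability of a continuation that still runs on plant
  \<open>z\<close>. The later moves are averaged over unplanted answers, so all calls are counted on
  the unplanted side.\<close>

lemma hybrid_bound:
  fixes orc :: "access \<Rightarrow> answer pmf" and orc' :: "'z \<Rightarrow> access \<Rightarrow> answer pmf"
  assumes adv: "\<And>q (f :: 'z \<Rightarrow> answer \<Rightarrow> real). (\<And>z r. 0 \<le> f z r \<and> f z r \<le> 1) \<Longrightarrow>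
      (\<Sum>z\<in>Z. measure_pmf.expectation (orc' z q) (f z) - measure_pmf.expectation (orc q) (f z)) \<le> 1"
  shows "(\<Sum>z\<in>Z. pmf (run (orc' z) t alg) (g z) - pmf (run orc t alg) (g z)) \<le> calls_upto orc t alg"
proof (induction t arbitrary: alg)
  case 0
  show ?case by (simp add: calls_upto_def)
next
  case (Suc t)
  define F where "F = (\<lambda>o' z m. case m of
       Inl i \<Rightarrow> of_bool (g z = Some i)
     | Inr (q, continue) \<Rightarrow> measure_pmf.expectation (o' q) (\<lambda>r. pmf (run o' t (continue r)) (g z)))"
  have F: "pmf (run o' (Suc t) alg) (g z) = measure_pmf.expectation (move alg) (F o' z)" for o' z
    unfolding pmf_run_Suc F_def ..
  have F_bounds: "0 \<le> F o' z m \<and> F o' z m \<le> 1" for o' z m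
    unfolding F_def by (auto split: sum.split intro!: expectation_bounds simp: pmf_le_1)
  have F_int: "integrable (measure_pmf (move alg)) (F o' z)" for o' z
    by (rule integrable_pmf_bounded[where B = 1]) (metis F_bounds abs_of_nonneg)
  have K_bounds: "0 \<le> measure_pmf.expectation (orc q) (\<lambda>r. calls_upto orc t (c r))"
    "measure_pmf.expectation (orc q) (\<lambda>r. calls_upto orc t (c r)) \<le> real t" for q c
    using expectation_bounds[of 0 "\<lambda>r. calls_upto orc t (c r)" "real t"] by (auto simp: calls_upto_bounds)
  have step: "(\<Sum>z\<in>Z. F (orc' z) z m - F orc z m) \<le> (case m of Inl i \<Rightarrow> 0
     | Inr (q, c) \<Rightarrow> 1 + measure_pmf.expectation (orc q) (\<lambda>r. calls_upto orc t (c r)))" for m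
  proof (cases m)
    case (Inl i)
    then show ?thesis by (simp add: F_def)
  next
    case (Inr qc)
    obtain q c where m: "m = Inr (q, c)" using Inr by (cases qc) auto
    let ?f = "\<lambda>z r. pmf (run (orc' z) t (c r)) (g z)" and ?h = "\<lambda>z r. pmf (run orc t (c r)) (g z)"
    \<comment> \<open>The inserted hybrid is an unplanted answer followed by the planted
      continuation: the first sum changes only the answer to this call, the second only what follows
      it.\<close>
    have "(\<Sum>z\<in>Z. F (orc' z) z m - F orc z m) =
       (\<Sum>z\<in>Z. measure_pmf.expectation (orc' z q) (?f z) - measure_pmf.expectation (orc q) (?f z)) +
       (\<Sum>z\<in>Z. measure_pmf.expectation (orc q) (?f z) - measure_pmf.expectation (orc q) (?h z))"
      by (simp add: m F_def flip: sum.distrib)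
    also have "\<dots> \<le> 1 + (\<Sum>z\<in>Z. measure_pmf.expectation (orc q) (?f z) - measure_pmf.expectation (orc q) (?h z))"
      by (intro add_right_mono adv[where f = ?f and q = q]) (simp add: pmf_le_1)
    also have "(\<Sum>z\<in>Z. measure_pmf.expectation (orc q) (?f z) - measure_pmf.expectation (orc q) (?h z)) =
       measure_pmf.expectation (orc q) (\<lambda>r. \<Sum>z\<in>Z. ?f z r - ?h z r)"
      by (simp add: Bochner_Integration.integral_sum integrable_pmf_fun)
    also have "\<dots> \<le> measure_pmf.expectation (orc q) (\<lambda>r. calls_upto orc t (c r))"
      by (intro integral_mono Suc.IH Bochner_Integration.integrable_sum integrable_calls_upto
          Bochner_Integration.integrable_diff integrable_pmf_fun)
    finally show ?thesis by (simp add: m)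
  qed
  have "(\<Sum>z\<in>Z. pmf (run (orc' z) (Suc t) alg) (g z) - pmf (run orc (Suc t) alg) (g z)) =
      measure_pmf.expectation (move alg) (\<lambda>m. \<Sum>z\<in>Z. F (orc' z) z m - F orc z m)"
    by (simp add: F F_int Bochner_Integration.integral_sum del: run.simps)
  also have "\<dots> \<le> calls_upto orc (Suc t) alg"
    unfolding calls_upto_Suc
  proof (rule integral_mono)
    show "integrable (measure_pmf (move alg)) (\<lambda>m. \<Sum>z\<in>Z. F (orc' z) z m - F orc z m)"
      by (intro Bochner_Integration.integrable_sum Bochner_Integration.integrable_diff F_int)
    show "integrable (measure_pmf (move alg)) (\<lambda>m. case m of Inl i \<Rightarrow> 0
     | Inr (q, c) \<Rightarrow> 1 + measure_pmf.expectation (orc q) (\<lambda>r. calls_upto orc t (c r)))"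
      by (rule integrable_pmf_bounded[where B = "1 + real t"])
        (auto split: sum.split intro!: K_bounds simp: abs_of_nonneg K_bounds)
  qed (rule step)
  finally show ?case .
qed

text \<open>The output probabilities of truncated runs converge on both sides, while the hybrid
  bound of each truncation is a partial sum of the series for the expected calls, so the inequality
  survives the limit.\<close>

lemma expected_calls_lower_bound:
  fixes orc :: "access \<Rightarrow> answer pmf" and orc' :: "'z \<Rightarrow> access \<Rightarrow> answer pmf"
  assumes adv: "\<And>q (f :: 'z \<Rightarrow> answer \<Rightarrow> real). (\<And>z r. 0 \<le> f z r \<and> f z r \<le> 1) \<Longrightarrow>
      (\<Sum>z\<in>Z. measure_pmf.expectation (orc' z q) (f z) - measure_pmf.expectation (orc q) (f z)) \<le> 1"
    and p: "samples_from orc alg p" and p': "\<And>z. z \<in> Z \<Longrightarrow> samples_from (orc' z) alg (p' z)"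
  shows "ennreal (\<Sum>z\<in>Z. pmf (p' z) (g z) - pmf p (g z)) \<le> expected_calls orc alg"
proof (rule LIMSEQ_le_const2)
  let ?d = "\<lambda>t. \<Sum>z\<in>Z. pmf (run (orc' z) t alg) (Some (g z)) - pmf (run orc t alg) (Some (g z))"
  have "?d \<longlonglongrightarrow> (\<Sum>z\<in>Z. pmf (p' z) (g z) - pmf p (g z))"
    using p p' by (intro tendsto_sum tendsto_diff) (auto simp: samples_from_def)
  then show "(\<lambda>t. ennreal (?d t)) \<longlonglongrightarrow> ennreal (\<Sum>z\<in>Z. pmf (p' z) (g z) - pmf p (g z))"
    by (rule tendsto_ennrealI)
  have "ennreal (?d t) \<le> expected_calls orc alg" for t
  proof -
    have "ennreal (?d t) \<le> ennreal (calls_upto orc t alg)"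
      by (rule ennreal_leI[OF hybrid_bound], rule adv) simp
    also have "\<dots> = (\<Sum>s<t. ennreal (pmf (run orc (Suc s) alg) None))"
      unfolding calls_upto_def by (simp add: sum_ennreal)
    also have "\<dots> \<le> expected_calls orc alg"
      unfolding expected_calls_def by (intro sum_le_suminf) auto
    finally show ?thesis .
  qed
  then show "\<exists>N. \<forall>t\<ge>N. ennreal (?d t) \<le> expected_calls orc alg" by blast
qed

section \<open>The graph of the mesh is bipartite\<close>

text \<open>The displacement from the base vertex to vertex \<open>i\<close> is h times the sum of
  the first \<open>i\<close> unit vectors in the order \<sigma>, so the conditions defining a hat
  gradient become conditions on partial sums of its components.\<close>

lemma scalar_prod_kuhn_vertex:
  fixes g :: "real vec"
  assumes c: "c \<in> carrier_vec d" and \<sigma>: "\<sigma> permutes {..<d}" and i: "i \<le> d"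
    and g: "g \<in> carrier_vec d"
  shows "g \<bullet> (h \<cdot>\<^sub>v map_vec real_of_int (kuhn_vertex c \<sigma> i - c)) = h * (\<Sum>r<i. g $ \<sigma> r)"
proof -
  have sub: "\<sigma> ` {..<i} \<subseteq> {..<d}"
    using permutes_image[OF \<sigma>] i by (metis image_mono lessThan_subset_iff)
  have "g \<bullet> (h \<cdot>\<^sub>v map_vec real_of_int (kuhn_vertex c \<sigma> i - c)) =
      (\<Sum>r<d. g $ r * (h * of_bool (r \<in> \<sigma> ` {..<i})))"
    using c by (simp add: scalar_prod_def kuhn_vertex_def atLeast0LessThan)
  also have "\<dots> = (\<Sum>r\<in>\<sigma> ` {..<i}. h * g $ r)"
    using sub by (intro sum.mono_neutral_cong_right) auto
  also have "\<dots> = (\<Sum>r<i. h * g $ \<sigma> r)"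
    using permutes_inj_on[OF \<sigma>] by (simp add: sum.reindex)
  finally show ?thesis by (simp add: sum_distrib_left)
qed

text \<open>Prescribed partial sums determine the components one after the other as successive
  differences; conversely, the vector of these differences meets all conditions by telescoping.
  Uniqueness and existence together justify the definite description.\<close>

lemma hat_gradient:
  assumes c: "c \<in> carrier_vec d" and \<sigma>: "\<sigma> permutes {..<d}" and h: "h \<noteq> 0"
  shows "hat_gradient d h c \<sigma> v \<in> carrier_vec d"
    and "i < d \<Longrightarrow> hat_gradient d h c \<sigma> v $ \<sigma> i =
      (of_bool (kuhn_vertex c \<sigma> (Suc i) = v) - of_bool (kuhn_vertex c \<sigma> i = v)) / h"
proof -
  let ?a = "\<lambda>i. of_bool (kuhn_vertex c \<sigma> i = v) :: real"
  let ?P = "\<lambda>g. g \<in> carrier_vec d \<and> (\<forall>i\<le>d. g \<bullet> (h \<cdot>\<^sub>v map_vec real_of_int (kuhn_vertex c \<sigma> i - c)) =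
        ?a i - of_bool (c = v))"
  define g0 where "g0 = vec d (\<lambda>r. (?a (Suc (inv_into UNIV \<sigma> r)) - ?a (inv_into UNIV \<sigma> r)) / h)"
  have \<sigma>_less: "\<sigma> i < d" if "i < d" for i
    using permutes_in_image[OF \<sigma>, of i] that by auto
  have inv: "inv_into UNIV \<sigma> (\<sigma> i) = i" "\<sigma> (inv_into UNIV \<sigma> i) = i" for i
    using permutes_inverses[OF \<sigma>] by auto
  have v0: "kuhn_vertex c \<sigma> 0 = c" using c by (auto simp: kuhn_vertex_def)
  have P0: "?P g0"
  proof (intro conjI allI impI)
    show car: "g0 \<in> carrier_vec d" by (simp add: g0_def)
    fix i assume i: "i \<le> d"
    have "h * (\<Sum>r<i. g0 $ \<sigma> r) = (\<Sum>r<i. ?a (Suc r) - ?a r)"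
      unfolding sum_distrib_left using i h \<sigma>_less by (intro sum.cong) (auto simp: g0_def inv)
    also have "\<dots> = ?a i - ?a 0" by (rule sum_lessThan_telescope)
    finally show "g0 \<bullet> (h \<cdot>\<^sub>v map_vec real_of_int (kuhn_vertex c \<sigma> i - c)) = ?a i - of_bool (c = v)"
      unfolding scalar_prod_kuhn_vertex[OF c \<sigma> i car] v0 .
  qed
  have val: "g $ \<sigma> i = (?a (Suc i) - ?a i) / h" if "?P g" "i < d" for g i
  proof -
    have "h * (\<Sum>r<Suc i. g $ \<sigma> r) - h * (\<Sum>r<i. g $ \<sigma> r) = ?a (Suc i) - ?a i"
      using that scalar_prod_kuhn_vertex[OF c \<sigma>, of "Suc i" g h]
        scalar_prod_kuhn_vertex[OF c \<sigma>, of i g h] by (simp only: Suc_leI less_imp_le) auto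
    then have "h * g $ \<sigma> i = ?a (Suc i) - ?a i" by (simp add: algebra_simps)
    then show ?thesis using h by (simp add: field_simps)
  qed
  have uniq: "g = g0" if "?P g" for g
  proof (rule eq_vecI)
    show "dim_vec g = dim_vec g0" using that P0 by auto
    fix r assume "r < dim_vec g0"
    then have r: "inv_into UNIV \<sigma> r < d"
      using permutes_in_image[OF permutes_inv[OF \<sigma>], of r] by (simp add: g0_def)
    show "g $ r = g0 $ r" using val[OF that r] val[OF P0 r] by (simp add: inv)
  qed
  have P: "?P (hat_gradient d h c \<sigma> v)"
    unfolding hat_gradient_def by (rule theI[of ?P, OF P0 uniq])
  then show "hat_gradient d h c \<sigma> v \<in> carrier_vec d" by blast
  show "hat_gradient d h c \<sigma> v $ \<sigma> i = (?a (Suc i) - ?a i) / h" if "i < d"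
    using val[OF P that] .
qed

text \<open>Its parity is the two-colouring of the mesh vertices: each step along the path through a
  Kuhn simplex raises it by 1.\<close>

definition coord_sum :: "int vec \<Rightarrow> int" where
  "coord_sum v = (\<Sum>r<dim_vec v. v $ r)"

lemma coord_sum_kuhn_vertex_Suc:
  assumes c: "c \<in> carrier_vec d" and \<sigma>: "\<sigma> permutes {..<d}" and i: "i < d"
  shows "coord_sum (kuhn_vertex c \<sigma> (Suc i)) = coord_sum (kuhn_vertex c \<sigma> i) + 1"
proof -
  have \<sigma>i: "\<sigma> i < d" using permutes_in_image[OF \<sigma>, of i] i by auto
  have notin: "\<sigma> i \<notin> \<sigma> ` {..<i}" using permutes_inj[OF \<sigma>] by (auto dest: injD)
  have "(\<Sum>r<d. c $ r + of_bool (r \<in> \<sigma> ` {..<Suc i})) =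
      (\<Sum>r<d. (c $ r + of_bool (r \<in> \<sigma> ` {..<i})) + (if r = \<sigma> i then 1 else 0))"
    using notin by (intro sum.cong) (auto simp: lessThan_Suc)
  also have "\<dots> = (\<Sum>r<d. c $ r + of_bool (r \<in> \<sigma> ` {..<i})) + 1"
    using \<sigma>i by (subst sum.distrib) simp
  finally show ?thesis using c by (simp add: coord_sum_def kuhn_vertex_def)
qed

text \<open>The component of a hat gradient along a step of the path through the vertices of the simplex
  vanishes unless the hat sits at an end of that step, so only consecutive vertices couple.\<close>

lemma laplace_coupling_same_parity:
  assumes C: "C \<subseteq> carrier_vec d" and h: "h \<noteq> 0"
    and neq: "v \<noteq> w" and parity: "even (coord_sum v) = even (coord_sum w)"
  shows "laplace_coupling d h C v w = 0"
proof -
  have "hat_gradient d h c \<sigma> v \<bullet> hat_gradient d h c \<sigma> w = 0"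
    if "c \<in> C" and \<sigma>: "\<sigma> permutes {..<d}" for c \<sigma>
  proof -
    have c: "c \<in> carrier_vec d" using that C by auto
    let ?g = "\<lambda>v. hat_gradient d h c \<sigma> v"
    have zero: "?g v $ \<sigma> i * ?g w $ \<sigma> i = 0" if "i < d" for i
    proof (rule ccontr)
      assume "?g v $ \<sigma> i * ?g w $ \<sigma> i \<noteq> 0"
      then have "{v, w} \<subseteq> {kuhn_vertex c \<sigma> (Suc i), kuhn_vertex c \<sigma> i}"
        by (auto simp: hat_gradient(2)[OF c \<sigma> h that] split: if_splits)
      then show False
        using neq parity coord_sum_kuhn_vertex_Suc[OF c \<sigma> that] by auto
    qed
    have "?g v \<bullet> ?g w = (\<Sum>r<d. ?g v $ r * ?g w $ r)"
      using hat_gradient(1)[OF c \<sigma> h, of w] by (simp add: scalar_prod_def atLeast0LessThan)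
    also have "\<dots> = (\<Sum>i<d. ?g v $ \<sigma> i * ?g w $ \<sigma> i)"
      by (rule sum.permute[OF \<sigma>, unfolded o_def])
    finally show ?thesis using zero by simp
  qed
  then show ?thesis by (simp add: laplace_coupling_def)
qed

text \<open>The two parity classes partition the nodes, and both are independent, so neither exceeds
  the maximum.\<close>

lemma indep_size_ge_half:
  assumes D: "valid_discretization D"
  shows "num_nodes D \<le> 2 * indep_size D"
proof -
  define S where "S b = {i\<in>{..<num_nodes D}. even (coord_sum (node D i)) = b}" for b
  have inj: "inj_on (node D) {..<num_nodes D}"
    using D by (auto simp: valid_discretization_def bij_betw_def)
  have "independent_set D (S b)" for b
    unfolding independent_set_def
  proof (intro conjI ballI)
    fix i j assume ij: "i \<in> S b" "j \<in> S b"
    show "\<not> adjacent D i j"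
    proof (cases "i = j")
      case False
      then have "node D i \<noteq> node D j" using ij inj by (auto simp: S_def inj_on_def)
      then have "laplace_coupling (space_dim D) (mesh_size D) (cells D) (node D i) (node D j) = 0"
        using ij D by (intro laplace_coupling_same_parity) (auto simp: S_def valid_discretization_def)
      then show ?thesis by (simp add: adjacent_def)
    qed (simp add: adjacent_def)
  qed (auto simp: S_def)
  then have "card (S b) \<le> indep_size D" for b
    using D unfolding valid_discretization_def by blast
  moreover have "card {..<num_nodes D} = card (S True) + card (S False)"
    by (subst card_Un_disjoint[symmetric]) (auto simp: S_def intro!: arg_cong[where f = card] simp del: card_lessThan)
  ultimately have "card {..<num_nodes D} \<le> indep_size D + indep_size D"
    by (metis add_mono)
  then show ?thesis by simp
qed

section \<open>Block matrices\<close>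

text \<open>In a sorted list each key occupies a contiguous segment. This is what allows matrices
  defined block by block over the nodes to be read edge by edge.\<close>

lemma concat_filter_keys:
  fixes f :: "'a \<Rightarrow> nat"
  assumes "sorted (map f xs)"
  shows "concat (map (\<lambda>j. filter (\<lambda>x. f x = j) xs) [0..<m]) = filter (\<lambda>x. f x < m) xs"
proof (induction m)
  case 0
  then show ?case by simp
next
  case (Suc m)
  have "filter (\<lambda>x. f x < m) ys @ filter (\<lambda>x. f x = m) ys = filter (\<lambda>x. f x < Suc m) ys"
    if "sorted (map f ys)" for ys
    using that
  proof (induction ys)
    case (Cons y ys)
    have "filter (\<lambda>x. f x < m) ys = []" if "\<not> f y < m"
      using Cons.prems that by (auto simp: filter_empty_conv)
    then show ?case using Cons by (auto simp: less_Suc_eq)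
  qed simp
  from this[OF assms] show ?case by (simp add: Suc)
qed

lemma dim_kron_identity [simp]:
  "dim_row (1\<^sub>m m \<otimes>\<^sub>m mat_of_cols n [v]) = m * n"
  "dim_col (1\<^sub>m m \<otimes>\<^sub>m mat_of_cols n [v]) = m"
  by (simp_all add: kron_mat_def)

lemma kron_identity_index:
  assumes "r < m * dim_vec v" "c < m"
  shows "(1\<^sub>m m \<otimes>\<^sub>m column_mat v) $$ (r, c) =
    (if r div dim_vec v = c then v $ (r mod dim_vec v) else 0)"
proof -
  have "0 < dim_vec v" using assms(1) by (cases "dim_vec v") auto
  moreover have "r div dim_vec v < m" using assms(1) by (simp add: less_mult_imp_div_less)
  ultimately show ?thesis using assms by (simp add: kron_mat_def mat_of_cols_def)
qed

lemma smult_kron_identity: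
  "a \<cdot>\<^sub>m (1\<^sub>m m \<otimes>\<^sub>m column_mat v) = 1\<^sub>m m \<otimes>\<^sub>m column_mat (a \<cdot>\<^sub>v v)"
proof (rule eq_matI)
  fix i j assume "i < dim_row (1\<^sub>m m \<otimes>\<^sub>m column_mat (a \<cdot>\<^sub>v v))"
    "j < dim_col (1\<^sub>m m \<otimes>\<^sub>m column_mat (a \<cdot>\<^sub>v v))"
  then have ij: "i < m * dim_vec v" "j < m" by auto
  then have "0 < dim_vec v" by (cases "dim_vec v") auto
  then show "(a \<cdot>\<^sub>m (1\<^sub>m m \<otimes>\<^sub>m column_mat v)) $$ (i, j) =
      (1\<^sub>m m \<otimes>\<^sub>m column_mat (a \<cdot>\<^sub>v v)) $$ (i, j)"
    using ij kron_identity_index[of i m v j] kron_identity_index[of i m "a \<cdot>\<^sub>v v" j] by simp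
qed auto

text \<open>Turns the nested blocks into one formula: row \<open>r\<close> stands for the item
  \<open>r div n\<close> of the concatenated list and the position \<open>r mod n\<close>. The
  function \<open>s\<close> recovers the vector of a block from any item in it, so block boundaries
  disappear from later computations.\<close>

lemma diag_block_kron_identity:
  assumes "\<And>j x. j \<in> set js \<Longrightarrow> x \<in> set (E j) \<Longrightarrow> v j = s x"
    and "\<And>j. j \<in> set js \<Longrightarrow> dim_vec (v j) = n"
  shows "diag_block_mat (map (\<lambda>j. 1\<^sub>m (length (E j)) \<otimes>\<^sub>m column_mat (v j)) js) =
    mat (length (concat (map E js)) * n) (length (concat (map E js)))
      (\<lambda>(r, c). if r div n = c then s (concat (map E js) ! c) $ (r mod n) else 0)"
  using assms
proof (induction js)
  case Nil
  then show ?case by auto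
next
  case (Cons j js)
  let ?m = "length (E j)" and ?L = "length (concat (map E js))"
  let ?A = "1\<^sub>m ?m \<otimes>\<^sub>m column_mat (v j)"
  let ?Q = "mat (?L * n) ?L (\<lambda>(r, c). if r div n = c then s (concat (map E js) ! c) $ (r mod n) else 0)"
  have IH: "diag_block_mat (map (\<lambda>j. 1\<^sub>m (length (E j)) \<otimes>\<^sub>m column_mat (v j)) js) = ?Q"
    by (rule Cons.IH) (use Cons.prems in auto)
  have dv: "dim_vec (v j) = n" using Cons.prems by simp
  have eq: "diag_block_mat (map (\<lambda>j. 1\<^sub>m (length (E j)) \<otimes>\<^sub>m column_mat (v j)) (j # js)) =
      four_block_mat ?A (0\<^sub>m (?m * n) ?L) (0\<^sub>m (?L * n) ?m) ?Q" (is "_ = ?F")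
    by (simp only: list.map diag_block_mat.simps IH Let_def dim_row_mat dim_col_mat dim_kron_identity dv)
  show ?case
    unfolding eq
  proof (rule eq_matI, goal_cases)
    case (1 r c)
    then have "r < length (concat (map E (j # js))) * n" "c < length (concat (map E (j # js)))"
      by (simp_all only: dim_row_mat dim_col_mat)
    then have r: "r < ?m * n + ?L * n" and c: "c < ?m + ?L"
      by (simp_all only: list.map concat.simps length_append add_mult_distrib)
    then have n: "0 < n" by (cases n) auto
    have F: "?F $$ (r, c) = (if r < ?m * n then if c < ?m then ?A $$ (r, c) else 0
        else if c < ?m then 0 else ?Q $$ (r - ?m * n, c - ?m))"
      using r c by (subst index_mat_four_block) (auto simp: dv)
    have rhs: "mat (length (concat (map E (j # js))) * n) (length (concat (map E (j # js))))
      (\<lambda>(r, c). if r div n = c then s (concat (map E (j # js)) ! c) $ (r mod n) else 0) $$ (r, c) =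
      (if r div n = c then s ((E j @ concat (map E js)) ! c) $ (r mod n) else 0)"
      using r c by (subst index_mat(1)) (simp_all add: add_mult_distrib)
    show ?case
    proof (cases "r < ?m * n")
      case True
      then have rd: "r div n < ?m" by (simp add: less_mult_imp_div_less)
      have "?A $$ (r, c) = (if r div n = c then v j $ (r mod n) else 0)" if "c < ?m"
        using kron_identity_index[of r ?m "v j" c] that True dv by simp
      then show ?thesis
        unfolding F rhs using True rd Cons.prems(1)[of j "E j ! c"]
        by (auto simp: nth_append simp del: index_mat)
    next
      case False
      then obtain r' where r': "r = ?m * n + r'" by (metis le_iff_add not_less)
      then have r'2: "r' < ?L * n" using r by simp
      have d: "r div n = ?m + r' div n" "r mod n = r' mod n" using n by (auto simp: r')
      have "?Q $$ (r', c - ?m) =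
          (if r' div n = c - ?m then s (concat (map E js) ! (c - ?m)) $ (r' mod n) else 0)" if "\<not> c < ?m"
        using c r'2 that by (subst index_mat(1)) auto
      moreover have "r - ?m * n = r'" by (simp add: r')
      ultimately show ?thesis
        unfolding F rhs d using False by (auto simp: nth_append simp del: index_mat)
    qed
  qed (simp_all add: dv add_mult_distrib)
qed

lemma dim_foldr_append_kron:
  assumes "\<And>j. j \<in> set js \<Longrightarrow> dim_vec (v j) = n"
  shows "dim_vec (foldr (@\<^sub>v) (map (\<lambda>j. vec_of_list (map a (E j)) \<otimes>\<^sub>v v j) js) (0\<^sub>v (m * n))) =
      (length (concat (map E js)) + m) * n"
  using assms by (induction js) (auto simp: kron_vec_def add_mult_distrib simp del: vec_of_list_map)

text \<open>The counterpart for the right-hand side, in the same row numbering; the final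
  \<open>m * n\<close> coordinates form the zero block.\<close>

lemma foldr_append_kron:
  assumes "\<And>j x. j \<in> set js \<Longrightarrow> x \<in> set (E j) \<Longrightarrow> v j = s x"
    and "\<And>j. j \<in> set js \<Longrightarrow> dim_vec (v j) = n" and r: "r < (length (concat (map E js)) + m) * n"
  shows "foldr (@\<^sub>v) (map (\<lambda>j. vec_of_list (map a (E j)) \<otimes>\<^sub>v v j) js) (0\<^sub>v (m * n)) $ r =
      (if r div n < length (concat (map E js))
       then a (concat (map E js) ! (r div n)) * s (concat (map E js) ! (r div n)) $ (r mod n) else 0)"
  using assms
proof (induction js arbitrary: r)
  case Nil
  then show ?case by simp
next
  case (Cons j js)
  let ?m = "length (E j)"
  have dv: "dim_vec (v j) = n" using Cons.prems(2) by simp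
  have n: "0 < n" using Cons.prems(3) by (cases n) auto
  have dk: "dim_vec (vec_of_list (map a (E j)) \<otimes>\<^sub>v v j) = ?m * n" by (simp add: kron_vec_def dv)
  have dimr: "dim_vec (foldr (@\<^sub>v) (map (\<lambda>j. vec_of_list (map a (E j)) \<otimes>\<^sub>v v j) js) (0\<^sub>v (m * n))) =
    (length (concat (map E js)) + m) * n"
    by (rule dim_foldr_append_kron) (use Cons.prems(2) in simp)
  show ?case
  proof (cases "r < ?m * n")
    case True
    then have rd: "r div n < ?m" by (simp add: less_mult_imp_div_less)
    then have "v j = s (E j ! (r div n))" using Cons.prems(1) by simp
    moreover have "(vec_of_list (map a (E j)) \<otimes>\<^sub>v v j) $ r = a (E j ! (r div n)) * v j $ (r mod n)"
      using True rd by (simp add: kron_vec_def dv vec_of_list_index del: vec_of_list_map)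
    ultimately show ?thesis
      using True rd dk dimr by (simp add: nth_append del: vec_of_list_map)
  next
    case False
    then obtain r' where r': "r = ?m * n + r'" by (metis le_iff_add not_less)
    then have r'2: "r' < (length (concat (map E js)) + m) * n"
      using Cons.prems(3) by (simp add: add_mult_distrib)
    have d: "r div n = ?m + r' div n" "r mod n = r' mod n" using n by (auto simp: r')
    have "foldr (@\<^sub>v) (map (\<lambda>j. vec_of_list (map a (E j)) \<otimes>\<^sub>v v j) (j # js)) (0\<^sub>v (m * n)) $ r =
       foldr (@\<^sub>v) (map (\<lambda>j. vec_of_list (map a (E j)) \<otimes>\<^sub>v v j) js) (0\<^sub>v (m * n)) $ r'"
      using False dk dimr r'2 by (simp add: r' del: vec_of_list_map)
    also have "\<dots> = (if r' div n < length (concat (map E js))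
     then a (concat (map E js) ! (r' div n)) * s (concat (map E js) ! (r' div n)) $ (r' mod n) else 0)"
      using r'2 Cons.prems by (intro Cons.IH) auto
    finally show ?thesis by (simp add: d nth_append)
  qed
qed

section \<open>The linear systems\<close>

lemma sum_div_mod:
  fixes f :: "nat \<Rightarrow> nat \<Rightarrow> 'a :: comm_monoid_add"
  assumes "0 < n"
  shows "(\<Sum>r<m * n. f (r div n) (r mod n)) = (\<Sum>e<m. \<Sum>l<n. f e l)"
proof -
  have "(\<Sum>r<m * n. f (r div n) (r mod n)) = (\<Sum>e<m. \<Sum>r = e * n..<e * n + n. f (r div n) (r mod n))"
    by (rule sum.nat_group[symmetric])
  also have "\<dots> = (\<Sum>e<m. \<Sum>l<n. f e l)"
  proof (rule sum.cong[OF refl])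
    fix e
    have "(\<Sum>r = e * n..<e * n + n. f (r div n) (r mod n)) =
        (\<Sum>l = 0..<n. f ((l + e * n) div n) ((l + e * n) mod n))"
      using sum.shift_bounds_nat_ivl[of "\<lambda>r. f (r div n) (r mod n)" 0 "e * n" n] by (simp add: add.commute)
    then show "(\<Sum>r = e * n..<e * n + n. f (r div n) (r mod n)) = (\<Sum>l<n. f e l)"
      using assms by (simp add: atLeast0LessThan)
  qed
  finally show ?thesis .
qed

section \<open>Least squares and the normal equations\<close>

lemma l2_norm_square: "(l2_norm v)\<^sup>2 = (\<Sum>i<dim_vec v. (v $ i)\<^sup>2)"
  by (simp add: l2_norm_def scalar_prod_def atLeast0LessThan power2_eq_square sum_nonneg)

lemma l2_norm_smult: "l2_norm (a \<cdot>\<^sub>v v) = \<bar>a\<bar> * l2_norm v"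
  by (simp add: l2_norm_def real_sqrt_mult flip: mult.assoc)

lemma mult_mat_vec_scalar_prod:
  fixes P :: "real mat"
  assumes "P \<in> carrier_mat m d" "w \<in> carrier_vec d" "r \<in> carrier_vec m"
  shows "(P *\<^sub>v w) \<bullet> r = w \<bullet> (transpose_mat P *\<^sub>v r)"
proof -
  have "(P *\<^sub>v w) \<bullet> r = (transpose_mat (transpose_mat P) *\<^sub>v w) \<bullet> r" by simp
  also have "\<dots> = w \<bullet> (transpose_mat P *\<^sub>v r)"
    using assms by (intro transpose_vec_mult_scalar) auto
  finally show ?thesis .
qed

lemma l2_norm_add_square:
  assumes "x \<in> carrier_vec m" "y \<in> carrier_vec m"
  shows "(l2_norm (x + y))\<^sup>2 = (l2_norm x)\<^sup>2 + 2 * (y \<bullet> x) + (l2_norm y)\<^sup>2"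
proof -
  have "dim_vec x = m" "dim_vec y = m" using assms by auto
  then show ?thesis
    unfolding l2_norm_square scalar_prod_def
    by (simp add: power2_sum sum.distrib sum_distrib_left atLeast0LessThan algebra_simps)
qed

text \<open>The vector \<open>g\<close> is the gradient of the objective at \<open>u\<close>. If it
  vanishes, the residual is orthogonal to the range of \<open>P\<close> and any displacement adds a
  square; otherwise a short step against \<open>g\<close> lowers the objective.\<close>

lemma least_squares_iff_normal_equations:
  fixes P :: "real mat"
  assumes P: "P \<in> carrier_mat m d" and b: "b \<in> carrier_vec m" and u: "u \<in> carrier_vec d"
  shows "is_arg_min (\<lambda>u. 1 / 2 * (l2_norm (P *\<^sub>v u - b))\<^sup>2) (\<lambda>u. u \<in> carrier_vec d) u \<longleftrightarrow>
    transpose_mat P *\<^sub>v (P *\<^sub>v u) = transpose_mat P *\<^sub>v b"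
proof -
  define r where "r = P *\<^sub>v u - b"
  define g where "g = transpose_mat P *\<^sub>v r"
  have Pu: "P *\<^sub>v u \<in> carrier_vec m" using P u by simp
  have r: "r \<in> carrier_vec m" using Pu b by (simp add: r_def)
  have Pt: "transpose_mat P \<in> carrier_mat d m" using P by simp
  have g: "g \<in> carrier_vec d" using Pt r by (simp add: g_def)
  have g_eq: "g = transpose_mat P *\<^sub>v (P *\<^sub>v u) - transpose_mat P *\<^sub>v b"
    unfolding g_def r_def by (rule mult_minus_distrib_mat_vec[OF Pt Pu b])
  have "transpose_mat P *\<^sub>v (P *\<^sub>v u) = transpose_mat P *\<^sub>v b \<longleftrightarrow> g = 0\<^sub>v d"
  proof
    assume "g = 0\<^sub>v d"
    show "transpose_mat P *\<^sub>v (P *\<^sub>v u) = transpose_mat P *\<^sub>v b" (is "?x = ?y")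
    proof (rule eq_vecI)
      fix i assume i: "i < dim_vec ?y"
      then have "(?x - ?y) $ i = 0" using \<open>g = 0\<^sub>v d\<close> P g_eq by simp
      then show "?x $ i = ?y $ i" using i by simp
    qed simp
  next
    assume "transpose_mat P *\<^sub>v (P *\<^sub>v u) = transpose_mat P *\<^sub>v b"
    then show "g = 0\<^sub>v d" unfolding g_eq using Pt b by (simp add: minus_cancel_vec)
  qed
  also have "\<dots> \<longleftrightarrow> (\<forall>w\<in>carrier_vec d. (l2_norm r)\<^sup>2 \<le> (l2_norm (r + P *\<^sub>v w))\<^sup>2)"
  proof
    assume g0: "g = 0\<^sub>v d"
    show "\<forall>w\<in>carrier_vec d. (l2_norm r)\<^sup>2 \<le> (l2_norm (r + P *\<^sub>v w))\<^sup>2"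
    proof
      fix w :: "real vec" assume w: "w \<in> carrier_vec d"
      have "(P *\<^sub>v w) \<bullet> r = 0"
        using mult_mat_vec_scalar_prod[OF P w r] w g0 by (simp add: g_def)
      then show "(l2_norm r)\<^sup>2 \<le> (l2_norm (r + P *\<^sub>v w))\<^sup>2"
        using l2_norm_add_square[OF r, of "P *\<^sub>v w"] P w by simp
    qed
  next
    assume min: "\<forall>w\<in>carrier_vec d. (l2_norm r)\<^sup>2 \<le> (l2_norm (r + P *\<^sub>v w))\<^sup>2"
    define a q where "a = g \<bullet> g" and "q = (l2_norm (P *\<^sub>v g))\<^sup>2"
    \<comment> \<open>Exact line search would take \<open>a / q\<close>. The added 1 keeps the
      quotient meaningful when \<open>P\<close> annihilates \<open>g\<close>, and minimality still
      forces \<open>t\<^sup>2 * (q + 2) \<le> 0\<close>.\<close>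
    define t where "t = a / (q + 1)"
    have q: "q \<ge> 0" by (simp add: q_def)
    have w: "- t \<cdot>\<^sub>v g \<in> carrier_vec d" using g by simp
    have Pw: "P *\<^sub>v (- t \<cdot>\<^sub>v g) = - t \<cdot>\<^sub>v (P *\<^sub>v g)"
      by (rule mult_mat_vec[OF P g])
    have Pg: "P *\<^sub>v g \<in> carrier_vec m" using P g by simp
    have "(l2_norm r)\<^sup>2 \<le> (l2_norm r)\<^sup>2 + 2 * ((- t \<cdot>\<^sub>v (P *\<^sub>v g)) \<bullet> r) + (l2_norm (- t \<cdot>\<^sub>v (P *\<^sub>v g)))\<^sup>2"
      using min[rule_format, OF w] unfolding Pw
      by (subst (asm) l2_norm_add_square[OF r]) (use Pg in auto)
    also have "(- t \<cdot>\<^sub>v (P *\<^sub>v g)) \<bullet> r = - t * a"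
      unfolding smult_scalar_prod_distrib[OF Pg r] mult_mat_vec_scalar_prod[OF P g r] a_def
      by (simp only: g_def)
    also have "(l2_norm (- t \<cdot>\<^sub>v (P *\<^sub>v g)))\<^sup>2 = t\<^sup>2 * q"
      by (simp add: l2_norm_smult power_mult_distrib q_def)
    finally have le: "2 * (t * a) \<le> t\<^sup>2 * q" by linarith
    have ta: "a = t * (q + 1)" using q by (simp add: t_def)
    have "t\<^sup>2 * (q + 2) = 2 * (t * a) - t\<^sup>2 * q"
      unfolding ta by (simp add: power2_eq_square distrib_left)
    then have "t\<^sup>2 * (q + 2) \<le> 0" using le by linarith
    then have "t = 0" using q by (simp add: mult_le_0_iff)
    then have "a = 0" using ta by simp
    then have "\<forall>i<d. g $ i = 0"
      using g by (simp add: a_def scalar_prod_def sum_nonneg_eq_0_iff)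
    then show "g = 0\<^sub>v d" using g by (intro eq_vecI) auto
  qed
  also have "\<dots> \<longleftrightarrow> (\<forall>y\<in>carrier_vec d. (l2_norm r)\<^sup>2 \<le> (l2_norm (P *\<^sub>v y - b))\<^sup>2)"
  proof -
    have shift: "r + P *\<^sub>v (y - u) = P *\<^sub>v y - b" if y: "y \<in> carrier_vec d" for y :: "real vec"
    proof (rule eq_vecI)
      fix i assume "i < dim_vec (P *\<^sub>v y - b)"
      then have "i < m" using b by simp
      then show "(r + P *\<^sub>v (y - u)) $ i = (P *\<^sub>v y - b) $ i"
        unfolding mult_minus_distrib_mat_vec[OF P y u] r_def
        using carrier_matD[OF P] carrier_vecD[OF b] by (simp del: index_mult_mat_vec)
    qed (use P b in simp)
    show ?thesis
    proof (intro iffI ballI)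
      fix y :: "real vec"
      assume "\<forall>w\<in>carrier_vec d. (l2_norm r)\<^sup>2 \<le> (l2_norm (r + P *\<^sub>v w))\<^sup>2" and y: "y \<in> carrier_vec d"
      then have "(l2_norm r)\<^sup>2 \<le> (l2_norm (r + P *\<^sub>v (y - u)))\<^sup>2"
        using u by simp
      then show "(l2_norm r)\<^sup>2 \<le> (l2_norm (P *\<^sub>v y - b))\<^sup>2" by (simp only: shift[OF y])
    next
      fix w :: "real vec"
      assume min: "\<forall>y\<in>carrier_vec d. (l2_norm r)\<^sup>2 \<le> (l2_norm (P *\<^sub>v y - b))\<^sup>2" and w: "w \<in> carrier_vec d"
      have wu: "w + u \<in> carrier_vec d" using w u by simp
      have "w + u - u = w" using w u by (intro eq_vecI) auto
      then show "(l2_norm r)\<^sup>2 \<le> (l2_norm (r + P *\<^sub>v w))\<^sup>2"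
        using min[rule_format, OF wu] shift[OF wu] by simp
    qed
  qed
  finally show ?thesis using u by (auto simp: is_arg_min_def r_def not_less)
qed

section \<open>Edgewise form of the matrix \<open>B_mat\<close> and of the right-hand side\<close>

definition edge_key :: "discretization \<Rightarrow> nat \<times> nat \<Rightarrow> nat" where
  "edge_key D p = min (indep_size D) (min (fst p) (snd p))"

definition edge_block :: "discretization \<Rightarrow> nat \<Rightarrow> (nat \<times> nat) list" where
  "edge_block D j = filter (\<lambda>p. edge_key D p = j) (edges D)"

definition incidence :: "nat \<times> nat \<Rightarrow> nat \<Rightarrow> real" where
  "incidence p j = of_bool (snd p = j) - of_bool (fst p = j)"

text \<open>The column of \<open>B_mat\<close> at an edge of key \<open>j\<close> consists of this
  vector in the \<open>n\<close> rows of that edge and of zeros elsewhere. The last case serves the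
  edges with no endpoint in the independent set.\<close>

definition slot_vec :: "discretization \<Rightarrow> nat \<Rightarrow> (nat \<Rightarrow> nat \<Rightarrow> bool) \<Rightarrow> nat \<Rightarrow> real vec" where
  "slot_vec D n T j = (if j = 0 then unit_vec n 0
     else if j < indep_size D then t_bar n (T j) else (1 / sqrt (real n)) \<cdot>\<^sub>v ones n)"

lemma dim_t_bar [simp]: "dim_vec (t_bar n s) = n"
  by (simp add: t_bar_def t_vec_def)

lemma dim_slot_vec [simp]: "dim_vec (slot_vec D n T j) = n"
  by (simp add: slot_vec_def)

lemma l2_norm_t_vec: "l2_norm (t_vec n s) = sqrt (real (hamming_weight n s))"
proof -
  have "t_vec n s \<bullet> t_vec n s = (\<Sum>l<n. of_bool (s l))"
    by (simp add: t_vec_def scalar_prod_def atLeast0LessThan flip: of_bool_conj)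
  also have "\<dots> = real (hamming_weight n s)"
    by (simp add: hamming_weight_def of_bool_def sum.If_cases Int_def)
  finally show ?thesis by (simp add: l2_norm_def)
qed

lemma t_bar_index:
  "l < n \<Longrightarrow> t_bar n s $ l = of_bool (s l) / sqrt (real (hamming_weight n s))"
  by (simp add: t_bar_def l2_norm_t_vec) (simp add: t_vec_def)

lemma t_bar_unit: "0 < hamming_weight n s \<Longrightarrow> t_bar n s \<bullet> t_bar n s = 1"
proof -
  assume w: "0 < hamming_weight n s"
  have "l2_norm (t_bar n s) = 1"
    using w unfolding t_bar_def l2_norm_smult by (simp add: l2_norm_t_vec)
  then show ?thesis by (simp add: l2_norm_def)
qed

text \<open>Positive weights make every \<open>t_bar\<close> in use a unit vector; at weight 0 the
  normalisation would divide by zero and leave the zero vector. A positive number of nodes makes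
  node 0 a member of the independent set.\<close>

locale mesh_system =
  fixes D :: discretization and n :: nat and T :: "nat \<Rightarrow> nat \<Rightarrow> bool"
  assumes valid: "valid_discretization D"
    and nodes: "0 < num_nodes D"
    and n: "0 < n"
    and weight: "\<And>j. j < indep_size D \<Longrightarrow> 0 < hamming_weight n (T j)"
begin

abbreviation "k \<equiv> indep_size D"
abbreviation "M \<equiv> num_edges D"
abbreviation "N \<equiv> num_nodes D"
abbreviation "key \<equiv> edge_key D"

lemma k_pos: "0 < k"
  using indep_size_ge_half[OF valid] nodes by simp

lemma k_le: "k \<le> N"
proof -
  have "{..<k} \<subseteq> {..<N}"
    using valid by (simp add: valid_discretization_def independent_set_def)
  then show ?thesis by simp
qed

lemma edge_endpoints:
  assumes "p \<in> set (edges D)"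
  shows "fst p \<noteq> snd p" "fst p < N" "snd p < N" "\<not> (fst p < k \<and> snd p < k)"
proof -
  obtain a b where p: "p = (a, b)" by (cases p)
  have "{a, b} \<in> set (map (\<lambda>(i, j). {i, j}) (edges D))"
    using assms p by force
  also have "\<dots> = {{i, j} | i j. i < N \<and> j < N \<and> adjacent D i j}"
    using valid by (simp add: valid_discretization_def)
  finally obtain i j where ij: "{a, b} = {i, j}" "i < N" "j < N" "adjacent D i j"
    by blast
  then have cases: "a = i \<and> b = j \<or> a = j \<and> b = i"
    by (simp add: doubleton_eq_iff)
  have "i \<noteq> j" using ij(4) by (simp add: adjacent_def)
  moreover have "\<not> (i < k \<and> j < k)"
    using valid ij(4) by (auto simp: valid_discretization_def independent_set_def)
  ultimately show "fst p \<noteq> snd p" "fst p < N" "snd p < N" "\<not> (fst p < k \<and> snd p < k)"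
    using cases ij(2,3) p by auto
qed

lemma edge_key_eq_iff:
  assumes "p \<in> set (edges D)" "j < k"
  shows "key p = j \<longleftrightarrow> fst p = j \<or> snd p = j"
  using edge_endpoints(4)[OF assms(1)] assms(2) by (auto simp: edge_key_def min_def)

lemma edge_key_le: "key p \<le> k"
  by (simp add: edge_key_def)

lemma sorted_keys: "sorted (map key (edges D))"
  using valid by (simp add: valid_discretization_def edge_key_def[abs_def] case_prod_beta')

lemma concat_edge_block:
  "concat (map (edge_block D) [0..<m]) = filter (\<lambda>p. key p < m) (edges D)"
  unfolding edge_block_def by (rule concat_filter_keys[OF sorted_keys])

lemma concat_edge_block_all: "concat (map (edge_block D) [0..<Suc k]) = edges D"
  unfolding concat_edge_block using edge_key_le by (simp add: less_Suc_eq_le)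

lemma degree_eq: "j < k \<Longrightarrow> degree D j = length (edge_block D j)"
  unfolding degree_def edge_block_def
  by (intro arg_cong[where f = length] filter_cong) (auto simp: edge_key_eq_iff case_prod_beta')

lemma rest_eq: "M - (\<Sum>j<k. degree D j) = length (edge_block D k)"
proof -
  have "M = length (concat (map (edge_block D) [0..<Suc k]))"
    by (simp only: concat_edge_block_all num_edges_def)
  also have "\<dots> = (\<Sum>j<k. length (edge_block D j)) + length (edge_block D k)"
    by (simp add: length_concat sum_list_distinct_conv_sum_set o_def atLeast0LessThan)
  finally show ?thesis by (simp add: degree_eq)
qed

lemma grad_index:
  "e < M \<Longrightarrow> j < N \<Longrightarrow> grad_mat D $$ (e, j) = incidence (edges D ! e) j"
  by (simp add: grad_mat_def incidence_def)

text \<open>The nonzero entries of column \<open>j\<close> of the gradient sit at the edges incident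
  to \<open>j\<close>, and these are the edges of key \<open>j\<close>, because no edge joins two
  nodes of the independent set.\<close>

lemma g_tilde_eq:
  assumes "j < k"
  shows "g_tilde D j = vec_of_list (map (\<lambda>p. incidence p j) (edge_block D j))"
proof -
  have jN: "j < N" using assms k_le by simp
  have "list_of_vec (col (grad_mat D) j) = map (\<lambda>p. incidence p j) (edges D)"
    using jN by (intro nth_equalityI)
      (auto simp: list_of_vec_index grad_mat_def incidence_def num_edges_def)
  then have "g_tilde D j = vec_of_list (map (\<lambda>p. incidence p j) (filter (\<lambda>p. incidence p j \<noteq> 0) (edges D)))"
    by (simp add: g_tilde_def nonzero_part_def filter_map o_def del: vec_of_list_map)
  also have "filter (\<lambda>p. incidence p j \<noteq> 0) (edges D) = edge_block D j"
    unfolding edge_block_def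
  proof (rule filter_cong[OF refl])
    fix p assume p: "p \<in> set (edges D)"
    show "incidence p j \<noteq> 0 \<longleftrightarrow> key p = j"
      unfolding edge_key_eq_iff[OF p assms]
      using edge_endpoints(1)[OF p] by (auto simp: incidence_def)
  qed
  finally show ?thesis .
qed

lemma upt_split: "[0..<Suc k] = [0] @ [1..<k] @ [k]" "[0..<k] = [0] @ [1..<k]"
  using k_pos by (simp_all add: upt_conv_Cons)

lemma B_mat_eq:
  "B_mat D n T = mat (M * n) M
     (\<lambda>(r, c). if r div n = c then slot_vec D n T (key (edges D ! c)) $ (r mod n) else 0)"
proof -
  have "B_mat D n T = diag_block_mat (map (\<lambda>j. 1\<^sub>m (length (edge_block D j)) \<otimes>\<^sub>m
      column_mat (slot_vec D n T j)) [0..<Suc k])"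
    unfolding B_mat_def rest_eq upt_split(1) map_append
    using k_pos by (intro arg_cong[where f = diag_block_mat] arg_cong2[where f = append])
      (auto simp: slot_vec_def degree_eq smult_kron_identity[of _ _ "ones n", simplified] simp del: One_nat_def)
  also have "\<dots> = mat (M * n) M
     (\<lambda>(r, c). if r div n = c then slot_vec D n T (key (edges D ! c)) $ (r mod n) else 0)"
    by (subst diag_block_kron_identity[where s = "\<lambda>p. slot_vec D n T (key p)" and n = n])
      (auto simp only: concat_edge_block_all num_edges_def dim_slot_vec, auto simp: edge_block_def)
  finally show ?thesis .
qed

definition rhs_slot :: "nat \<Rightarrow> real vec" where
  "rhs_slot j = (if j = 0 then unit_vec n 0 else real n \<cdot>\<^sub>v t_bar n (T 0))"

lemma kron_vec_smult: "a \<cdot>\<^sub>v (v \<otimes>\<^sub>v w) = v \<otimes>\<^sub>v (a \<cdot>\<^sub>v w)"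
proof (rule eq_vecI)
  fix i assume "i < dim_vec (v \<otimes>\<^sub>v (a \<cdot>\<^sub>v w))"
  then have i: "i < dim_vec v * dim_vec w" by (simp add: kron_vec_def)
  then have "i mod dim_vec w < dim_vec w" by (cases "dim_vec w") auto
  then show "(a \<cdot>\<^sub>v (v \<otimes>\<^sub>v w)) $ i = (v \<otimes>\<^sub>v (a \<cdot>\<^sub>v w)) $ i"
    using i by (simp add: kron_vec_def)
qed (simp add: kron_vec_def)

lemma b_vec_eq:
  "b_vec D n T = vec (M * n) (\<lambda>r. let p = edges D ! (r div n) in
     if key p < k then incidence p (key p) * rhs_slot (key p) $ (r mod n) else 0)"
proof -
  let ?a = "\<lambda>p. incidence p (key p)"
  let ?F = "foldr (@\<^sub>v) (map (\<lambda>j. vec_of_list (map ?a (edge_block D j)) \<otimes>\<^sub>v rhs_slot j) [0..<k])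
      (0\<^sub>v (length (edge_block D k) * n))"
  have g: "g_tilde D j = vec_of_list (map ?a (edge_block D j))" if "j < k" for j
    unfolding g_tilde_eq[OF that]
    by (intro arg_cong[where f = vec_of_list] map_cong) (auto simp: edge_block_def)
  have "b_vec D n T = ?F"
    unfolding b_vec_def rest_eq upt_split(2) map_append
    using k_pos by (intro arg_cong2[where f = "foldr (@\<^sub>v)"] arg_cong2[where f = append] refl)
      (auto simp: rhs_slot_def g kron_vec_smult simp del: One_nat_def vec_of_list_map)
  also have "\<dots> = vec (M * n) (\<lambda>r. let p = edges D ! (r div n) in
     if key p < k then incidence p (key p) * rhs_slot (key p) $ (r mod n) else 0)"
  proof -
    let ?L = "filter (\<lambda>p. key p < k) (edges D)"
    have split: "edges D = ?L @ edge_block D k"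
      using concat_edge_block_all concat_edge_block[of k] by (simp del: upt_Suc add: upt_Suc_append)
    have len: "length ?L + length (edge_block D k) = M"
      using arg_cong[OF split, of length] by (simp add: num_edges_def)
    have nth: "edges D ! i = (if i < length ?L then ?L ! i else edge_block D k ! (i - length ?L))" for i
      by (subst split) (rule nth_append)
    \<comment> \<open>As the keys are sorted, the zero block consists exactly of the edges behind
      the prefix \<open>?L\<close>.\<close>
    have low: "i < length ?L \<longleftrightarrow> key (edges D ! i) < k" if "i < M" for i
    proof (cases "i < length ?L")
      case True
      then have "?L ! i \<in> set ?L" by (rule nth_mem)
      then show ?thesis using True by (simp add: nth)
    next
      case False
      then have "edge_block D k ! (i - length ?L) \<in> set (edge_block D k)"
        using that len by (intro nth_mem) auto
      then show ?thesis using False by (simp add: nth edge_block_def)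
    qed
    have dim: "dim_vec ?F = M * n"
      by (subst dim_foldr_append_kron) (simp_all add: concat_edge_block len rhs_slot_def)
    show ?thesis
    proof (rule eq_vecI)
      fix r assume "r < dim_vec (vec (M * n) (\<lambda>r. let p = edges D ! (r div n) in
        if key p < k then incidence p (key p) * rhs_slot (key p) $ (r mod n) else 0))"
      then have r: "r < M * n" by simp
      then have rd: "r div n < M" by (simp add: less_mult_imp_div_less)
      have Fr: "?F $ r = (if r div n < length ?L
         then ?a (?L ! (r div n)) * rhs_slot (key (?L ! (r div n))) $ (r mod n) else 0)"
        unfolding concat_edge_block[symmetric]
      proof (rule foldr_append_kron)
        show "rhs_slot j = rhs_slot (key p)" if "p \<in> set (edge_block D j)" for j p
          using that by (simp add: edge_block_def)
        show "r < (length (concat (map (edge_block D) [0..<k])) + length (edge_block D k)) * n"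
          using r by (simp only: concat_edge_block len)
      qed (simp add: rhs_slot_def)
      show "?F $ r = vec (M * n) (\<lambda>r. let p = edges D ! (r div n) in
        if key p < k then incidence p (key p) * rhs_slot (key p) $ (r mod n) else 0) $ r"
      proof (cases "r div n < length ?L")
        case True
        then have e: "?L ! (r div n) = edges D ! (r div n)" by (simp only: nth if_True)
        have "key (edges D ! (r div n)) < k" using True low[OF rd] by blast
        with Fr[unfolded if_P[OF True] e] r show ?thesis by (simp add: Let_def)
      next
        case False
        then have "\<not> key (edges D ! (r div n)) < k" using low[OF rd] by blast
        with Fr[unfolded if_not_P[OF False]] r show ?thesis by (simp add: Let_def)
      qed
    qed (simp add: dim del: vec_of_list_map)
  qed
  finally show ?thesis .
qed

section \<open>The system, its least-squares form and the prescribed solution\<close>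

lemma B_carrier: "B_mat D n T \<in> carrier_mat (M * n) M"
  and G_carrier: "grad_mat D \<in> carrier_mat M N"
  and b_carrier: "b_vec D n T \<in> carrier_vec (M * n)"
  and u_carrier: "u_star D n T \<in> carrier_vec N"
  by (simp_all add: B_mat_eq b_vec_eq grad_mat_def u_star_def)

lemma div_less: "r < M * n \<Longrightarrow> r div n < M"
  by (simp add: less_mult_imp_div_less)

lemma slot_unit: "(\<Sum>l<n. (slot_vec D n T j $ l)\<^sup>2) = 1"
proof -
  have *: "slot_vec D n T j \<bullet> slot_vec D n T j = 1"
    using n weight[of j] by (simp add: slot_vec_def t_bar_unit)
      (simp add: scalar_prod_def real_sqrt_mult_self field_simps)
  then show ?thesis
    by (simp add: scalar_prod_def atLeast0LessThan power2_eq_square)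
qed

text \<open>Different columns live in the rows of different edges, hence have disjoint supports, and
  each is a unit vector.\<close>

lemma BtB: "transpose_mat (B_mat D n T) * B_mat D n T = 1\<^sub>m M"
proof (rule eq_matI)
  fix i j assume "i < dim_row (1\<^sub>m M)" "j < dim_col (1\<^sub>m M)"
  then have ij: "i < M" "j < M" by auto
  let ?s = "\<lambda>i. slot_vec D n T (key (edges D ! i))"
  have "(transpose_mat (B_mat D n T) * B_mat D n T) $$ (i, j) =
      (\<Sum>r<M * n. (if r div n = i then ?s i $ (r mod n) else 0) * (if r div n = j then ?s j $ (r mod n) else 0))"
    using ij by (simp add: B_mat_eq scalar_prod_def atLeast0LessThan)
  also have "\<dots> = (\<Sum>e<M. \<Sum>l<n. (if e = i then ?s i $ l else 0) * (if e = j then ?s j $ l else 0))"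
    by (rule sum_div_mod[OF n])
  also have "\<dots> = (\<Sum>e<M. if e = i then (if i = j then 1 else 0) else 0)"
    by (intro sum.cong) (auto simp: slot_unit simp flip: power2_eq_square)
  also have "\<dots> = (if i = j then 1 else 0)" using ij by simp
  finally show "(transpose_mat (B_mat D n T) * B_mat D n T) $$ (i, j) = 1\<^sub>m M $$ (i, j)"
    using ij by simp
qed (simp_all add: B_mat_eq)

text \<open>Since \<open>u_star\<close> vanishes off the independent set, and an edge has at most
  one endpoint in that set, its difference along an edge is plus or minus its value at the key. This
  value is the inner product of the two slot vectors of that edge, one from the matrix and one from
  the right-hand side.\<close>

lemma Bt_b: "transpose_mat (B_mat D n T) *\<^sub>v b_vec D n T = grad_mat D *\<^sub>v u_star D n T"
proof (rule eq_vecI)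
  fix e assume "e < dim_vec (grad_mat D *\<^sub>v u_star D n T)"
  then have e: "e < M" by (simp add: grad_mat_def)
  define p where "p = edges D ! e"
  have p: "p \<in> set (edges D)" using e by (simp add: p_def num_edges_def)
  let ?s = "slot_vec D n T (key p)" and ?u = "u_star D n T"
  have "(transpose_mat (B_mat D n T) *\<^sub>v b_vec D n T) $ e =
      (\<Sum>r<M * n. (if r div n = e then ?s $ (r mod n) else 0) *
        (let p = edges D ! (r div n) in
          if key p < k then incidence p (key p) * rhs_slot (key p) $ (r mod n) else 0))"
    unfolding p_def using e by (simp add: B_mat_eq b_vec_eq scalar_prod_def atLeast0LessThan)
  also have "\<dots> = (\<Sum>e'<M. \<Sum>l<n. (if e' = e then ?s $ l else 0) *
        (let p = edges D ! e' in if key p < k then incidence p (key p) * rhs_slot (key p) $ l else 0))"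
    by (rule sum_div_mod[OF n])
  also have "\<dots> = (\<Sum>e'<M. if e' = e then
       (if key p < k then incidence p (key p) * (?s \<bullet> rhs_slot (key p)) else 0) else 0)"
    by (intro sum.cong) (auto simp: p_def Let_def scalar_prod_def rhs_slot_def sum_distrib_left atLeast0LessThan mult_ac)
  also have "\<dots> = (if key p < k then incidence p (key p) * (?s \<bullet> rhs_slot (key p)) else 0)"
    using e by simp
  also have "\<dots> = (if key p < k then incidence p (key p) * ?u $ key p else 0)"
  proof (cases "key p < k")
    case True
    have "?s \<bullet> rhs_slot (key p) = ?u $ key p"
    proof (cases "key p = 0")
      case True
      then show ?thesis using n nodes by (simp add: slot_vec_def rhs_slot_def u_star_def)
    next
      case False
      then show ?thesis using True n nodes k_le
        by (simp add: slot_vec_def rhs_slot_def u_star_def comm_scalar_prod[of _ n] carrier_vecI)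
    qed
    then show ?thesis by simp
  qed simp
  also have "\<dots> = ?u $ snd p - ?u $ fst p"
  proof -
    have u0: "?u $ i = 0" if "k \<le> i" "i < N" for i
      using that k_pos nodes by (simp add: u_star_def)
    note ep = edge_endpoints[OF p]
    show ?thesis
    proof (cases "key p < k")
      case True
      then consider "fst p = key p" "k \<le> snd p" | "snd p = key p" "k \<le> fst p"
        using ep(4) by (auto simp: edge_key_def min_def split: if_splits)
      then show ?thesis
        using True ep by cases (auto simp: incidence_def u0)
    next
      case False
      then have "k \<le> fst p" "k \<le> snd p" by (auto simp: edge_key_def)
      then show ?thesis using False ep u0 by simp
    qed
  qed
  also have "\<dots> = (\<Sum>j<N. incidence p j * ?u $ j)"
  proof -
    note ep = edge_endpoints[OF p]
    have "(\<Sum>j<N. incidence p j * ?u $ j) =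
        (\<Sum>j<N. (if j = snd p then ?u $ snd p else 0) - (if j = fst p then ?u $ fst p else 0))"
      by (intro sum.cong) (auto simp: incidence_def)
    also have "\<dots> = ?u $ snd p - ?u $ fst p"
      unfolding sum_subtractf using ep(2,3) by simp
    finally show ?thesis by simp
  qed
  also have "\<dots> = (grad_mat D *\<^sub>v ?u) $ e"
  proof -
    have "(grad_mat D *\<^sub>v ?u) $ e = (\<Sum>j<N. grad_mat D $$ (e, j) * ?u $ j)"
      using e carrier_matD[OF G_carrier] carrier_vecD[OF u_carrier]
      by (simp add: scalar_prod_def atLeast0LessThan)
    also have "\<dots> = (\<Sum>j<N. incidence p j * ?u $ j)"
      using e by (intro sum.cong) (auto simp: grad_index p_def)
    finally show ?thesis by simp
  qed
  finally show "(transpose_mat (B_mat D n T) *\<^sub>v b_vec D n T) $ e = (grad_mat D *\<^sub>v ?u) $ e" .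
qed (simp add: B_mat_eq grad_mat_def)

lemma mesh_size_powi_nonzero: "mesh_size D powi (int (space_dim D) - 2) \<noteq> 0"
  using valid by (simp add: valid_discretization_def)

lemma A_mult_vec:
  assumes "u \<in> carrier_vec N"
  shows "A_mat D *\<^sub>v u = mesh_size D powi (int (space_dim D) - 2) \<cdot>\<^sub>v
      (transpose_mat (grad_mat D) *\<^sub>v (grad_mat D *\<^sub>v u))"
proof -
  have "transpose_mat (grad_mat D) *\<^sub>v (grad_mat D *\<^sub>v u) = (transpose_mat (grad_mat D) * grad_mat D) *\<^sub>v u"
    using G_carrier assms by (intro assoc_mult_mat_vec[symmetric]) auto
  then show ?thesis
    using assms by (auto simp: A_mat_def grad_mat_def intro!: eq_vecI)
qed

lemma A_u_star: "A_mat D *\<^sub>v u_star D n T = f_vec D n T"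
proof -
  have "A_mat D *\<^sub>v u_star D n T = mesh_size D powi (int (space_dim D) - 2) \<cdot>\<^sub>v
      (transpose_mat (grad_mat D) *\<^sub>v (grad_mat D *\<^sub>v u_star D n T))"
    using A_mult_vec[OF u_carrier] .
  then show ?thesis by (simp add: f_vec_def Bt_b)
qed

text \<open>Because the columns of \<open>B_mat\<close> are orthonormal, \<open>B_mat\<close>
  cancels from the quadratic part of the normal equations, which then are the system
  \<open>A u = f\<close> up to a nonzero power of the mesh size.\<close>

lemma A_mult_eq_f_iff:
  assumes u: "u \<in> carrier_vec N"
  shows "A_mat D *\<^sub>v u = f_vec D n T \<longleftrightarrow> least_squares_solution D n T u"
proof -
  let ?B = "B_mat D n T" and ?G = "grad_mat D" and ?b = "b_vec D n T"
  let ?c = "mesh_size D powi (int (space_dim D) - 2)"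
  have Bt: "transpose_mat ?B \<in> carrier_mat M (M * n)" and Gt: "transpose_mat ?G \<in> carrier_mat N M"
    using B_carrier G_carrier by auto
  have P: "BG_mat D n T \<in> carrier_mat (M * n) N"
    unfolding BG_mat_def using B_carrier G_carrier by simp
  have "transpose_mat (BG_mat D n T) *\<^sub>v (BG_mat D n T *\<^sub>v u) =
      transpose_mat ?G *\<^sub>v (transpose_mat ?B *\<^sub>v (?B *\<^sub>v (?G *\<^sub>v u)))"
    unfolding BG_mat_def transpose_mult[OF B_carrier G_carrier]
    using B_carrier G_carrier u by (simp add: assoc_mult_mat_vec[OF B_carrier G_carrier u]
        assoc_mult_mat_vec[OF Gt Bt mult_mat_vec_carrier[OF B_carrier mult_mat_vec_carrier[OF G_carrier u]]])
  also have "transpose_mat ?B *\<^sub>v (?B *\<^sub>v (?G *\<^sub>v u)) = ?G *\<^sub>v u"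
    using G_carrier u
    by (simp add: assoc_mult_mat_vec[OF Bt B_carrier mult_mat_vec_carrier[OF G_carrier u], symmetric] BtB)
  finally have lhs: "transpose_mat (BG_mat D n T) *\<^sub>v (BG_mat D n T *\<^sub>v u) =
      transpose_mat ?G *\<^sub>v (?G *\<^sub>v u)" .
  have rhs: "transpose_mat (BG_mat D n T) *\<^sub>v ?b = transpose_mat ?G *\<^sub>v (transpose_mat ?B *\<^sub>v ?b)"
    unfolding BG_mat_def transpose_mult[OF B_carrier G_carrier]
    by (rule assoc_mult_mat_vec[OF Gt Bt b_carrier])
  have inj: "x = y" if "?c \<cdot>\<^sub>v x = ?c \<cdot>\<^sub>v y" "dim_vec x = dim_vec y" for x y :: "real vec"
    using that mesh_size_powi_nonzero
    by (metis (no_types, lifting) eq_vecI index_smult_vec(1) mult_cancel_left)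
  have "A_mat D *\<^sub>v u = f_vec D n T \<longleftrightarrow>
      transpose_mat ?G *\<^sub>v (?G *\<^sub>v u) = transpose_mat ?G *\<^sub>v (transpose_mat ?B *\<^sub>v ?b)"
    unfolding A_mult_vec[OF u] f_vec_def by (auto dest: inj)
  then show ?thesis
    unfolding least_squares_solution_def least_squares_iff_normal_equations[OF P b_carrier u] lhs rhs .
qed

end

section \<open>Planted instances\<close>

lemma l2_norm_nonneg: "0 \<le> l2_norm v"
  by (simp add: l2_norm_def scalar_prod_def sum_nonneg)

lemma pmf_l2_pmf:
  assumes "v \<noteq> 0\<^sub>v (dim_vec v)"
  shows "pmf (l2_pmf v) i = (if i < dim_vec v then (v $ i)\<^sup>2 / (l2_norm v)\<^sup>2 else 0)"
  unfolding l2_pmf_def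
proof (rule pmf_embed_pmf)
  have "\<exists>i<dim_vec v. v $ i \<noteq> 0" using assms by (metis eq_vecI index_zero_vec)
  then have "(\<Sum>i<dim_vec v. (v $ i)\<^sup>2) > 0"
    by (auto intro!: sum_pos2)
  then have norm: "(\<Sum>i<dim_vec v. (v $ i)\<^sup>2 / (l2_norm v)\<^sup>2) = 1"
    by (simp add: l2_norm_square flip: sum_divide_distrib)
  have "(\<integral>\<^sup>+ i. ennreal (if i < dim_vec v then (v $ i)\<^sup>2 / (l2_norm v)\<^sup>2 else 0) \<partial>count_space UNIV) =
      (\<Sum>i<dim_vec v. ennreal (if i < dim_vec v then (v $ i)\<^sup>2 / (l2_norm v)\<^sup>2 else 0))"
    by (rule nn_integral_count_space') auto
  also have "\<dots> = (\<Sum>i<dim_vec v. ennreal ((v $ i)\<^sup>2 / (l2_norm v)\<^sup>2))"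
    by (intro sum.cong) auto
  also have "\<dots> = ennreal (\<Sum>i<dim_vec v. (v $ i)\<^sup>2 / (l2_norm v)\<^sup>2)"
    by (rule sum_ennreal) simp
  finally show "(\<integral>\<^sup>+ i. ennreal (if i < dim_vec v then (v $ i)\<^sup>2 / (l2_norm v)\<^sup>2 else 0) \<partial>count_space UNIV) = 1"
    by (simp add: norm)
qed simp

lemma expectation_sq_sample:
  fixes f :: "answer \<Rightarrow> real"
  assumes "v \<noteq> 0\<^sub>v (dim_vec v)"
  shows "measure_pmf.expectation (sq_answer v Sample) f =
    (\<Sum>i<dim_vec v. f (Index i) * ((v $ i)\<^sup>2 / (l2_norm v)\<^sup>2))"
proof -
  have "measure_pmf.expectation (sq_answer v Sample) f =
      measure_pmf.expectation (l2_pmf v) (\<lambda>i. f (Index i))"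
    using assms by simp
  also have "\<dots> = (\<Sum>i<dim_vec v. f (Index i) * pmf (l2_pmf v) i)"
    by (rule integral_measure_pmf_real)
      (auto simp: set_pmf_iff pmf_l2_pmf[OF assms] split: if_splits)
  finally show ?thesis by (simp add: pmf_l2_pmf[OF assms])
qed

context mesh_system
begin

lemma BG_dims: "dim_row (BG_mat D n T) = M * n" "dim_col (BG_mat D n T) = N"
  using B_carrier G_carrier by (auto simp: BG_mat_def)

text \<open>A row of \<open>B_mat\<close> has at most one nonzero entry, so a row of the product is
  a row of the gradient scaled by one slot coordinate. The bits influence a row through this single
  number only.\<close>

lemma BG_row:
  assumes r: "r < M * n"
  shows "row (BG_mat D n T) r = vec N (\<lambda>v.
    slot_vec D n T (key (edges D ! (r div n))) $ (r mod n) * incidence (edges D ! (r div n)) v)"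
proof (rule eq_vecI)
  fix v assume "v < dim_vec (vec N (\<lambda>v.
    slot_vec D n T (key (edges D ! (r div n))) $ (r mod n) * incidence (edges D ! (r div n)) v))"
  then have v: "v < N" by simp
  have "row (BG_mat D n T) r $ v = (\<Sum>c<M. B_mat D n T $$ (r, c) * grad_mat D $$ (c, v))"
    using r v carrier_matD[OF B_carrier] carrier_matD[OF G_carrier]
    by (simp add: BG_mat_def scalar_prod_def atLeast0LessThan)
  also have "\<dots> = (\<Sum>c<M. if c = r div n then
      slot_vec D n T (key (edges D ! (r div n))) $ (r mod n) * incidence (edges D ! (r div n)) v else 0)"
    using r v by (intro sum.cong) (auto simp: B_mat_eq grad_index)
  also have "\<dots> = slot_vec D n T (key (edges D ! (r div n))) $ (r mod n) * incidence (edges D ! (r div n)) v"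
    using div_less[OF r] by simp
  finally show "row (BG_mat D n T) r $ v = vec N (\<lambda>v.
    slot_vec D n T (key (edges D ! (r div n))) $ (r mod n) * incidence (edges D ! (r div n)) v) $ v"
    using v by simp
qed (simp add: BG_dims)

lemma sum_incidence_square:
  assumes "p \<in> set (edges D)"
  shows "(\<Sum>v<N. (incidence p v)\<^sup>2) = 2"
proof -
  note ep = edge_endpoints[OF assms]
  have "(\<Sum>v<N. (incidence p v)\<^sup>2) = (\<Sum>v<N. (if v = fst p then 1 else 0) + (if v = snd p then 1 else 0))"
    using ep(1) by (intro sum.cong) (auto simp: incidence_def)
  also have "\<dots> = 2" unfolding sum.distrib using ep(2,3) by simp
  finally show ?thesis .
qed

lemma dim_row_norms: "dim_vec (row_norms (BG_mat D n T)) = M * n"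
  by (simp add: row_norms_def BG_dims)

lemma row_norms_square:
  assumes r: "r < M * n"
  shows "(row_norms (BG_mat D n T) $ r)\<^sup>2 = 2 * (slot_vec D n T (key (edges D ! (r div n))) $ (r mod n))\<^sup>2"
proof -
  have "(row_norms (BG_mat D n T) $ r)\<^sup>2 = (l2_norm (row (BG_mat D n T) r))\<^sup>2"
    using r by (simp add: row_norms_def BG_dims)
  also have "\<dots> = (slot_vec D n T (key (edges D ! (r div n))) $ (r mod n))\<^sup>2 *
      (\<Sum>v<N. (incidence (edges D ! (r div n)) v)\<^sup>2)"
    unfolding BG_row[OF r] l2_norm_square by (simp add: power_mult_distrib sum_distrib_left)
  also have "(\<Sum>v<N. (incidence (edges D ! (r div n)) v)\<^sup>2) = 2"
    using div_less[OF r] by (intro sum_incidence_square) (simp add: num_edges_def)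
  finally show ?thesis by simp
qed

text \<open>Each edge contributes 2, the squared length of its gradient row, times the squared
  length 1 of its slot vector. The value does not depend on the bits, so asking for this norm
  reveals nothing.\<close>

lemma norm_row_norms_square: "(l2_norm (row_norms (BG_mat D n T)))\<^sup>2 = 2 * real M"
proof -
  have "(l2_norm (row_norms (BG_mat D n T)))\<^sup>2 =
      (\<Sum>r<M * n. 2 * (slot_vec D n T (key (edges D ! (r div n))) $ (r mod n))\<^sup>2)"
    unfolding l2_norm_square dim_row_norms by (intro sum.cong) (auto simp: row_norms_square)
  also have "\<dots> = (\<Sum>e<M. \<Sum>l<n. 2 * (slot_vec D n T (key (edges D ! e)) $ l)\<^sup>2)"
    by (rule sum_div_mod[OF n])
  finally show ?thesis by (simp add: slot_unit flip: sum_distrib_left)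
qed

lemma norm_row_norms: "l2_norm (row_norms (BG_mat D n T)) = sqrt (2 * real M)"
  by (rule real_sqrt_unique[OF norm_row_norms_square l2_norm_nonneg, symmetric])

lemma expectation_row_norms_sample:
  fixes f :: "answer \<Rightarrow> real"
  assumes "0 < M"
  shows "measure_pmf.expectation (sq_answer (row_norms (BG_mat D n T)) Sample) f =
    (\<Sum>r<M * n. f (Index r) * ((slot_vec D n T (key (edges D ! (r div n))) $ (r mod n))\<^sup>2 / real M))"
proof -
  let ?v = "row_norms (BG_mat D n T)"
  have "?v \<noteq> 0\<^sub>v (dim_vec ?v)"
  proof
    assume "?v = 0\<^sub>v (dim_vec ?v)"
    then have "?v \<bullet> ?v = 0" by (metis carrier_vec_dim_vec scalar_prod_left_zero)
    then have "l2_norm ?v = 0" by (simp add: l2_norm_def)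
    then show False using assms norm_row_norms by simp
  qed
  then have "measure_pmf.expectation (sq_answer ?v Sample) f =
      (\<Sum>r<M * n. f (Index r) * ((?v $ r)\<^sup>2 / (2 * real M)))"
    using expectation_sq_sample[of ?v f] unfolding dim_row_norms norm_row_norms_square by blast
  also have "\<dots> = (\<Sum>r<M * n. f (Index r) * ((slot_vec D n T (key (edges D ! (r div n))) $ (r mod n))\<^sup>2 / real M))"
    by (intro sum.cong refl) (simp add: row_norms_square)
  finally show ?thesis .
qed

end

section \<open>Unplanted and planted bit strings\<close>

lemma b_vec_cong: "T 0 = T' 0 \<Longrightarrow> b_vec D n T = b_vec D n T'"
  by (simp add: b_vec_def)

definition disjoint_bits :: "nat \<Rightarrow> nat \<Rightarrow> nat \<Rightarrow> bool" where
  "disjoint_bits w j l = (if j = 0 then l < w else w \<le> l \<and> l < 2 * w)"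

text \<open>Moving a bit preserves the weight \<open>w\<close> and hence the normalisation, so only
  the coordinates \<open>snd z\<close> and \<open>snd z + w\<close> of one \<open>t_bar\<close>
  change. The guard \<open>j \<noteq> 0\<close> keeps the string of node 0, and with it the
  right-hand side, fixed.\<close>

definition planted_bits :: "nat \<Rightarrow> nat \<times> nat \<Rightarrow> nat \<Rightarrow> nat \<Rightarrow> bool" where
  "planted_bits w z j l = (if j \<noteq> 0 \<and> j = fst z
     then l = snd z \<or> (w \<le> l \<and> l < 2 * w \<and> l \<noteq> snd z + w) else disjoint_bits w j l)"

lemma hamming_weight_disjoint_bits:
  assumes "2 * w \<le> n"
  shows "hamming_weight n (disjoint_bits w j) = w"
proof -
  have "{l. l < n \<and> disjoint_bits w j l} = (if j = 0 then {..<w} else {w..<2 * w})"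
    using assms by (auto simp: disjoint_bits_def)
  then show ?thesis by (simp add: hamming_weight_def)
qed

lemma hamming_weight_planted_bits:
  assumes "2 * w \<le> n" "snd z < w"
  shows "hamming_weight n (planted_bits w z j) = w"
proof (cases "j \<noteq> 0 \<and> j = fst z")
  case True
  have "{l. l < n \<and> planted_bits w z j l} = insert (snd z) ({w..<2 * w} - {snd z + w})"
    using assms True by (auto simp: planted_bits_def)
  moreover have "card ({w..<2 * w} - {snd z + w}) = w - 1"
    using assms by (subst card_Diff_singleton) auto
  ultimately show ?thesis using assms by (simp add: hamming_weight_def)
next
  case False
  then have "planted_bits w z j = disjoint_bits w j" by (auto simp: planted_bits_def)
  then show ?thesis by (simp add: hamming_weight_disjoint_bits[OF assms(1)])
qed

lemma slot_planted_eq: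
  assumes "2 * w \<le> n" "snd z < w" "l < n"
    and "\<not> (fst z = j \<and> (l = snd z \<or> l = snd z + w))"
  shows "slot_vec D n (planted_bits w z) j $ l = slot_vec D n (disjoint_bits w) j $ l"
  using assms by (auto simp: slot_vec_def t_bar_index hamming_weight_planted_bits
      hamming_weight_disjoint_bits planted_bits_def disjoint_bits_def)

text \<open>One-sided on purpose: the coordinate \<open>snd z\<close> gains 1 / w, the coordinate
  \<open>snd z + w\<close> loses as much, and a loss can only reduce the expectation of a
  nonnegative test.\<close>

lemma slot_planted_square_le:
  assumes "2 * w \<le> n" "snd z < w" "l < n"
  shows "(slot_vec D n (planted_bits w z) j $ l)\<^sup>2 \<le>
    (slot_vec D n (disjoint_bits w) j $ l)\<^sup>2 + (if z = (j, l) then 1 / real w else 0)"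
proof (cases "j \<noteq> 0 \<and> j < indep_size D")
  case True
  then show ?thesis using assms
    by (cases z) (auto simp: slot_vec_def t_bar_index hamming_weight_planted_bits
      hamming_weight_disjoint_bits planted_bits_def disjoint_bits_def power_divide)
next
  case False
  then show ?thesis by (auto simp: slot_vec_def)
qed

lemma sum_le_1_if_single:
  fixes g :: "'z \<Rightarrow> real"
  assumes "finite Z" "\<And>z. z \<in> Z \<Longrightarrow> z \<noteq> a \<Longrightarrow> g z = 0" "g a \<le> 1"
  shows "sum g Z \<le> 1"
proof -
  have "sum g Z = (\<Sum>z\<in>Z. if z = a then g a else 0)"
    using assms(2) by (intro sum.cong) auto
  then show ?thesis using assms(1,3) by simp
qed

lemma expectation_diff_le_1:
  fixes f :: "answer \<Rightarrow> real"
  assumes "\<And>r. 0 \<le> f r \<and> f r \<le> 1"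
  shows "measure_pmf.expectation p f - measure_pmf.expectation p' f \<le> 1"
  using expectation_bounds[of 0 f 1 p] expectation_bounds[of 0 f 1 p'] assms by fastforce

text \<open>A call to a single row, including a sample that merely shows whether the row is zero,
  depends on one slot coordinate and so separates at most one plant; the same holds for one entry of
  the row norms. A sample from the row norms can separate all plants, but only by small amounts
  whose sum is bounded by 1.\<close>

lemma planted_access_advantage:
  fixes f :: "nat \<times> nat \<Rightarrow> answer \<Rightarrow> real"
  assumes D: "valid_discretization D" "0 < num_nodes D" and w: "0 < w" "2 * w \<le> n"
    and f: "\<And>z r. 0 \<le> f z r \<and> f z r \<le> 1"
  shows "(\<Sum>z\<in>{1..<indep_size D} \<times> {..<w}.
      measure_pmf.expectation (system_access D n (planted_bits w z) q) (f z)
      - measure_pmf.expectation (system_access D n (disjoint_bits w) q) (f z)) \<le> 1"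
    (is "(\<Sum>z\<in>?Z. ?diff q z) \<le> 1")
proof -
  have sys0: "mesh_system D n (disjoint_bits w)"
    using D w by unfold_locales (auto simp: hamming_weight_disjoint_bits)
  have sys: "mesh_system D n (planted_bits w z)" if "z \<in> ?Z" for z
    using D w that by unfold_locales (auto simp: hamming_weight_planted_bits)
  let ?M = "num_edges D"
  define key where "key r = edge_key D (edges D ! (r div n))" for r
  have n: "0 < n" using w by simp
  have rhs: "b_vec D n (planted_bits w z) = b_vec D n (disjoint_bits w)" for z
    by (rule b_vec_cong) (auto simp: planted_bits_def)
  have mod: "r mod n < n" for r using n by simp
  \<comment> \<open>The only plant that can affect row \<open>r\<close>: positions below
    \<open>w\<close> react to an inserted bit, positions from \<open>w\<close> on to a removed one.
    For positions from \<open>2 * w\<close> on, the pair falls outside \<open>?Z\<close>, in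
    agreement with such rows never changing.\<close>
  let ?z = "\<lambda>r. (key r, if r mod n < w then r mod n else r mod n - w)"
  have slot: "slot_vec D n (planted_bits w z) (key r) $ (r mod n) =
      slot_vec D n (disjoint_bits w) (key r) $ (r mod n)" if "z \<in> ?Z" "z \<noteq> ?z r" for z r
    using that w mod[of r] by (intro slot_planted_eq) auto
  have row: "row (BG_mat D n (planted_bits w z)) r = row (BG_mat D n (disjoint_bits w)) r"
    if "r < ?M * n" "z \<in> ?Z" "z \<noteq> ?z r" for z r
    unfolding mesh_system.BG_row[OF sys[OF that(2)] that(1)] mesh_system.BG_row[OF sys0 that(1)]
    using slot[OF that(2,3)] by (simp add: key_def)
  have dims: "dim_row (BG_mat D n (planted_bits w z)) = ?M * n"
    "dim_vec (row_norms (BG_mat D n (planted_bits w z))) = ?M * n" if "z \<in> ?Z" for z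
    using mesh_system.BG_dims[OF sys[OF that]] mesh_system.dim_row_norms[OF sys[OF that]] by auto
  have dims0: "dim_row (BG_mat D n (disjoint_bits w)) = ?M * n"
    "dim_vec (row_norms (BG_mat D n (disjoint_bits w))) = ?M * n"
    using mesh_system.BG_dims[OF sys0] mesh_system.dim_row_norms[OF sys0] by auto
  have zero: "(\<Sum>z\<in>?Z. ?diff q z) \<le> 1" if "\<And>z. z \<in> ?Z \<Longrightarrow>
      system_access D n (planted_bits w z) q = system_access D n (disjoint_bits w) q" for q
    using that by simp
  have one: "(\<Sum>z\<in>?Z. ?diff q z) \<le> 1" if "\<And>z. z \<in> ?Z \<Longrightarrow> z \<noteq> a \<Longrightarrow>
      system_access D n (planted_bits w z) q = system_access D n (disjoint_bits w) q" for q a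
    by (rule sum_le_1_if_single[where a = a]) (use that in \<open>auto intro!: expectation_diff_le_1 f\<close>)
  show ?thesis
  proof (cases q)
    case (Rhs q')
    then show ?thesis by (intro zero) (simp add: rhs)
  next
    case (Row i q')
    show ?thesis
    proof (cases "i < ?M * n")
      case True
      then show ?thesis
        by (intro one[where a = "?z i"]) (simp add: Row dims dims0 row)
    next
      case False
      then show ?thesis by (intro zero) (simp add: Row dims dims0)
    qed
  next
    case (Row_Norms q')
    show ?thesis
    proof (cases q')
      case (Entry i)
      show ?thesis
      proof (cases "i < ?M * n")
        case True
        then show ?thesis
          by (intro one[where a = "?z i"]) (simp add: Row_Norms Entry row_norms_def dims dims0 row)
      next
        case False
        then show ?thesis by (intro zero) (simp add: Row_Norms Entry dims dims0)
      qed
    next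
      case Norm
      show ?thesis
        by (intro zero) (simp add: Row_Norms Norm mesh_system.norm_row_norms[OF sys]
            mesh_system.norm_row_norms[OF sys0])
    next
      case Sample
      show ?thesis
      proof (cases "?M = 0")
        case True
        have "v = 0\<^sub>v 0" if "dim_vec v = 0" for v :: "real vec"
          using that by (intro eq_vecI) auto
        then have "row_norms (BG_mat D n (planted_bits w z)) = row_norms (BG_mat D n (disjoint_bits w))"
          if "z \<in> ?Z" for z
          using dims(2)[OF that] dims0(2) True by (metis mult_0)
        then show ?thesis by (intro zero) (simp add: Row_Norms Sample)
      next
        case False
        then have M: "0 < ?M" by simp
        let ?s = "\<lambda>T r. (slot_vec D n T (key r) $ (r mod n))\<^sup>2"
        \<comment> \<open>The largest gain in probability of one sampled row: its squared slot
          coordinate rises by 1 / w, and the squares are normalised by the number of edges.\<close>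
        let ?c = "1 / (real w * real ?M)"
        have "?diff q z \<le> (\<Sum>r<?M * n. if z = (key r, r mod n) then ?c else 0)" if z: "z \<in> ?Z" for z
        proof -
          have snd_z: "snd z < w" using z by auto
          have "?diff q z = (\<Sum>r<?M * n. f z (Index r) *
              ((?s (planted_bits w z) r - ?s (disjoint_bits w) r) / real ?M))"
            unfolding Row_Norms Sample answer_access.simps
              mesh_system.expectation_row_norms_sample[OF sys[OF z] M]
              mesh_system.expectation_row_norms_sample[OF sys0 M] key_def
            by (simp add: sum_subtractf diff_divide_distrib right_diff_distrib)
          also have "\<dots> \<le> (\<Sum>r<?M * n. if z = (key r, r mod n) then ?c else 0)"
          proof (rule sum_mono)
            fix r
            let ?i = "if z = (key r, r mod n) then 1 / real w else 0"
            have "?s (planted_bits w z) r - ?s (disjoint_bits w) r \<le> ?i"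
              using slot_planted_square_le[OF w(2) snd_z mod[of r], of D "key r"] by linarith
            then have "f z (Index r) * ((?s (planted_bits w z) r - ?s (disjoint_bits w) r) / real ?M) \<le>
                f z (Index r) * (?i / real ?M)"
              using f by (intro mult_left_mono divide_right_mono) auto
            also have "\<dots> \<le> 1 * (?i / real ?M)"
              using f by (intro mult_right_mono) auto
            finally show "f z (Index r) * ((?s (planted_bits w z) r - ?s (disjoint_bits w) r) / real ?M) \<le>
                (if z = (key r, r mod n) then ?c else 0)" by (simp split: if_splits)
          qed
          finally show ?thesis .
        qed
        then have "(\<Sum>z\<in>?Z. ?diff q z) \<le> (\<Sum>z\<in>?Z. \<Sum>r<?M * n. if z = (key r, r mod n) then ?c else 0)"
          by (rule sum_mono)
        also have "\<dots> = (\<Sum>r<?M * n. \<Sum>z\<in>?Z. if z = (key r, r mod n) then ?c else 0)"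
          by (rule sum.swap)
        \<comment> \<open>After the exchange of sums each row meets at most one plant, and only at a
          position below \<open>w\<close>. There are \<open>w\<close> such positions per edge, so
          the gains \<open>?c\<close> add up to exactly 1.\<close>
        also have "\<dots> \<le> (\<Sum>r<?M * n. if r mod n < w then ?c else 0)"
          by (rule sum_mono) simp
        also have "\<dots> = (\<Sum>e<?M. \<Sum>l<n. if l < w then ?c else 0)"
          by (rule sum_div_mod[OF n, where f = "\<lambda>e l. if l < w then ?c else 0"])
        also have "(\<Sum>l<n. if l < w then ?c else 0) = (\<Sum>l<w. ?c)"
          using w by (intro sum.mono_neutral_cong_right) auto
        finally show ?thesis using w M by simp
      qed
    qed
  qed
qed

section \<open>The solutions of the planted systems\<close>

lemma t_bar_inner:
  assumes w: "0 < w" "hamming_weight n s = w" "hamming_weight n s' = w"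
  shows "t_bar n s \<bullet> t_bar n s' = real (card {l. l < n \<and> s l \<and> s' l}) / real w"
proof -
  have "t_bar n s \<bullet> t_bar n s' = (\<Sum>l<n. if s l \<and> s' l then 1 / real w else 0)"
    unfolding scalar_prod_def using assms
    by (intro sum.cong) (auto simp: t_bar_index atLeast0LessThan)
  also have "\<dots> = (\<Sum>l\<in>{l. l < n \<and> s l \<and> s' l}. 1 / real w)"
    by (intro sum.mono_neutral_cong_right) auto
  finally show ?thesis by simp
qed

lemma u_star_disjoint:
  assumes w: "0 < w" "2 * w \<le> n" and i: "i < num_nodes D"
  shows "u_star D n (disjoint_bits w) $ i = of_bool (i = 0)"
proof -
  have "{l. l < n \<and> disjoint_bits w 0 l \<and> disjoint_bits w i l} = {}" if "1 \<le> i"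
    using that by (auto simp: disjoint_bits_def)
  then show ?thesis using i w
    by (auto simp: u_star_def t_bar_inner[OF w(1)] hamming_weight_disjoint_bits[OF w(2)])
qed

text \<open>The planted string shares exactly the bit \<open>snd z\<close> with the string of node
  0, so the inner product is 1 / w.\<close>

lemma u_star_planted:
  assumes w: "0 < w" "2 * w \<le> n" and i: "i < num_nodes D"
    and z: "z \<in> {1..<indep_size D} \<times> {..<w}"
  shows "u_star D n (planted_bits w z) $ i =
    of_bool (i = 0) + (if i = fst z then real n / real w else 0)"
proof -
  have "{l. l < n \<and> planted_bits w z 0 l \<and> planted_bits w z i l} =
      (if i = fst z then {snd z} else {})" if "1 \<le> i"
    using that z w by (auto simp: planted_bits_def disjoint_bits_def)
  moreover have "snd z < w" using z by auto
  ultimately show ?thesis using i w z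
    by (auto simp: u_star_def t_bar_inner[OF w(1)] hamming_weight_planted_bits[OF w(2)])
qed

text \<open>With x the square of n / w, the planted node has probability x / (1 + x), against 0
  without the plant; \<open>2 * w \<le> n\<close> makes x at least 1.\<close>

lemma planted_success:
  assumes w: "0 < w" "2 * w \<le> n" and kN: "indep_size D \<le> num_nodes D"
    and z: "z \<in> {1..<indep_size D} \<times> {..<w}"
  shows "1 / 2 \<le> pmf (l2_pmf (u_star D n (planted_bits w z))) (fst z)
     - pmf (l2_pmf (u_star D n (disjoint_bits w))) (fst z)"
proof -
  let ?u = "u_star D n (planted_bits w z)" and ?v = "u_star D n (disjoint_bits w)"
  let ?N = "num_nodes D"
  have N: "0 < ?N" "fst z < ?N" "fst z \<noteq> 0" using z kN by auto
  have dim: "dim_vec ?u = ?N" "dim_vec ?v = ?N" by (simp_all add: u_star_def)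
  have nz: "?u \<noteq> 0\<^sub>v (dim_vec ?u)" "?v \<noteq> 0\<^sub>v (dim_vec ?v)"
    using u_star_disjoint[OF w N(1)] u_star_planted[OF w N(1) z] N dim
    by (metis add_0_right index_zero_vec(1) of_bool_eq(2) one_neq_zero)+
  define x where "x = (real n / real w)\<^sup>2"
  have x: "1 \<le> x" using w by (simp add: x_def)
  have "(l2_norm ?u)\<^sup>2 = (\<Sum>i<?N. (if i = 0 then 1 else 0) + (if i = fst z then x else 0))"
    unfolding l2_norm_square dim using N(3)
    by (intro sum.cong) (auto simp: u_star_planted[OF w _ z] x_def)
  also have "\<dots> = 1 + x" unfolding sum.distrib using N by simp
  finally have "pmf (l2_pmf ?u) (fst z) = x / (1 + x)"
    unfolding pmf_l2_pmf[OF nz(1)] using N by (simp add: dim u_star_planted[OF w _ z] x_def)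
  moreover have "pmf (l2_pmf ?v) (fst z) = 0"
    unfolding pmf_l2_pmf[OF nz(2)] using N by (simp add: dim u_star_disjoint[OF w])
  moreover have "1 / 2 \<le> x / (1 + x)" using x by (simp add: field_simps)
  ultimately show ?thesis by simp
qed

section \<open>From distinguishing plants to counting calls\<close>

lemma expected_calls_disjoint_bits:
  assumes D: "valid_discretization D" "0 < num_nodes D" and w: "0 < w" "2 * w \<le> n"
    and base: "solves_system alg D n (disjoint_bits w)"
    and planted: "\<And>z. z \<in> {1..<indep_size D} \<times> {..<w} \<Longrightarrow> solves_system alg D n (planted_bits w z)"
  shows "ennreal (real (indep_size D - 1) * real w / 2) \<le>
    expected_calls (system_access D n (disjoint_bits w)) alg"
proof -
  let ?Z = "{1..<indep_size D} \<times> {..<w}"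
  have "mesh_system D n (disjoint_bits w)"
    using D w by unfold_locales (auto simp: hamming_weight_disjoint_bits)
  then have kN: "indep_size D \<le> num_nodes D" by (rule mesh_system.k_le)
  have "real (indep_size D - 1) * real w / 2 = (\<Sum>z\<in>?Z. 1 / 2)" by simp
  also have "\<dots> \<le> (\<Sum>z\<in>?Z. pmf (l2_pmf (u_star D n (planted_bits w z))) (fst z)
     - pmf (l2_pmf (u_star D n (disjoint_bits w))) (fst z))"
    by (intro sum_mono planted_success w kN)
  finally have "ennreal (real (indep_size D - 1) * real w / 2) \<le>
      ennreal (\<Sum>z\<in>?Z. pmf (l2_pmf (u_star D n (planted_bits w z))) (fst z)
     - pmf (l2_pmf (u_star D n (disjoint_bits w))) (fst z))"
    by (rule ennreal_leI)
  also have "\<dots> \<le> expected_calls (system_access D n (disjoint_bits w)) alg"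
  \<comment> \<open>The event tested for the plant \<open>z\<close> is the output
    \<open>fst z\<close>, the node to which this plant moves the weight.\<close>
  proof (rule expected_calls_lower_bound[where orc' = "\<lambda>z. system_access D n (planted_bits w z)"])
    show "samples_from (system_access D n (disjoint_bits w)) alg (l2_pmf (u_star D n (disjoint_bits w)))"
      using base by (simp add: solves_system_def)
    show "samples_from (system_access D n (planted_bits w z)) alg (l2_pmf (u_star D n (planted_bits w z)))"
      if "z \<in> ?Z" for z
      using planted[OF that] by (simp add: solves_system_def)
  qed (rule planted_access_advantage[OF D w])
  finally show ?thesis .
qed

text \<open>Both constants are fixed before the dimension, the mesh and \<open>n\<close>, so each
  estimate below must be uniform in them. The hard instance is \<open>disjoint_bits w\<close> for
  every algorithm; correctness on the planted instances is what makes it expensive.\<close>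

theorem theorem4p9:
  fixes N_lo N_hi h_lo h_hi \<alpha> \<beta> :: real
  assumes "0 < N_lo" "N_lo \<le> N_hi" "0 < h_lo" "h_lo \<le> h_hi"
    and "0 < \<alpha>" "\<alpha> < 1 / 2" "\<alpha> < \<beta>" "\<beta> \<le> 1"
  shows "\<exists>c>0. \<exists>\<epsilon>\<^sub>0>0. \<forall>(D :: discretization) (n :: nat) (\<epsilon> :: real).
    valid_discretization D \<and> 0 < \<epsilon> \<and> \<epsilon> < \<epsilon>\<^sub>0 \<and>
    h_lo * \<epsilon> \<le> mesh_size D \<and> mesh_size D \<le> h_hi * \<epsilon> \<and>
    N_lo * (1 / \<epsilon>) ^ space_dim D \<le> real (num_nodes D) \<and>
    real (num_nodes D) \<le> N_hi * (1 / \<epsilon>) ^ space_dim D \<and>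
    n \<ge> 3200 * indep_size D \<longrightarrow>
    (\<forall>T\<in>admissible_bits \<alpha> \<beta> D n.
       A_mat D *\<^sub>v u_star D n T = f_vec D n T \<and>
       (\<forall>u\<in>carrier_vec (num_nodes D).
          A_mat D *\<^sub>v u = f_vec D n T \<longleftrightarrow> least_squares_solution D n T u)) \<and>
    (\<forall>alg. (\<forall>T\<in>admissible_bits \<alpha> \<beta> D n. solves_system alg D n T) \<longrightarrow>
       (\<exists>T\<in>admissible_bits \<alpha> \<beta> D n.
          ennreal (c * ((1 / \<epsilon>) ^ (2 * space_dim D) / (real (space_dim D) * ln (1 / \<epsilon>))))
            \<le> expected_calls (system_access D n T) alg))"
proof -
  \<comment> \<open>In the bound (k - 1) w / 2, the factor k - 1 is at least k / 2 and w is at least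
    3200 \<alpha> k. This gives 800 \<alpha> k^2 = 200 \<alpha> (2 k)^2, where 2 k is at least the
    number of nodes.\<close>
  define c where "c = 200 * \<alpha> * N_lo\<^sup>2"
  \<comment> \<open>In this order, the thresholds ensure that the logarithm is at least 1, that
    there are more than three nodes and hence k \<ge> 2, that rounding \<alpha> n up stays below
    \<beta> n, and that twice the rounded weight is at most n.\<close>
  define \<epsilon>\<^sub>0 where "\<epsilon>\<^sub>0 = Min {1 / 3, N_lo / 3, N_lo * (\<beta> - \<alpha>), N_lo * (1 - 2 * \<alpha>) / 2}"
  have c: "0 < c" using assms by (simp add: c_def)
  have \<epsilon>\<^sub>0: "0 < \<epsilon>\<^sub>0" using assms by (simp add: \<epsilon>\<^sub>0_def)
  have main: "(\<forall>T\<in>admissible_bits \<alpha> \<beta> D n.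
       A_mat D *\<^sub>v u_star D n T = f_vec D n T \<and>
       (\<forall>u\<in>carrier_vec (num_nodes D).
          A_mat D *\<^sub>v u = f_vec D n T \<longleftrightarrow> least_squares_solution D n T u)) \<and>
    (\<forall>alg. (\<forall>T\<in>admissible_bits \<alpha> \<beta> D n. solves_system alg D n T) \<longrightarrow>
       (\<exists>T\<in>admissible_bits \<alpha> \<beta> D n.
          ennreal (c * ((1 / \<epsilon>) ^ (2 * space_dim D) / (real (space_dim D) * ln (1 / \<epsilon>))))
            \<le> expected_calls (system_access D n T) alg))"
    if D: "valid_discretization D" and \<epsilon>: "0 < \<epsilon>" "\<epsilon> < \<epsilon>\<^sub>0"
      and N: "N_lo * (1 / \<epsilon>) ^ space_dim D \<le> real (num_nodes D)"
      and n: "n \<ge> 3200 * indep_size D" for D :: discretization and n :: nat and \<epsilon> :: real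
  proof -
    define d X k where "d = space_dim D" and "X = (1 / \<epsilon>) ^ d" and "k = indep_size D"
    have d: "1 \<le> d" using D by (simp add: valid_discretization_def d_def)
    have \<epsilon>_le: "\<epsilon> < 1 / 3" "\<epsilon> < N_lo / 3" "\<epsilon> < N_lo * (\<beta> - \<alpha>)" "\<epsilon> < N_lo * (1 - 2 * \<alpha>) / 2"
      using \<epsilon>(2) by (simp_all add: \<epsilon>\<^sub>0_def)
    \<comment> \<open>Reducing the power to 1 lets the thresholds on \<epsilon> work for all
      dimensions at once.\<close>
    have "(1 / \<epsilon>) ^ 1 \<le> X"
      unfolding X_def using \<epsilon> \<epsilon>_le(1) d by (intro power_increasing) auto
    then have "N_lo * (1 / \<epsilon>) \<le> N_lo * X" using assms by (intro mult_left_mono) auto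
    then have N_ge: "N_lo / \<epsilon> \<le> real (num_nodes D)" using N by (simp add: X_def d_def)
    have N_X: "N_lo * X \<le> real (num_nodes D)" using N by (simp add: X_def d_def)
    have half: "num_nodes D \<le> 2 * k"
      unfolding k_def by (rule indep_size_ge_half[OF D])
    have "3 < N_lo / \<epsilon>" using \<epsilon> \<epsilon>_le(2) by (simp add: field_simps)
    then have N3: "3 < num_nodes D" using N_ge by linarith
    have k2: "2 \<le> k" using N3 half by linarith
    have nN: "real (num_nodes D) \<le> real n" using half n by (simp add: k_def)
    have n_ge: "N_lo / \<epsilon> \<le> real n" using N_ge nN by linarith
    have n\<beta>: "1 \<le> real n * (\<beta> - \<alpha>)"
    proof -
      have "1 \<le> N_lo / \<epsilon> * (\<beta> - \<alpha>)" using \<epsilon> \<epsilon>_le(3) by (simp add: field_simps)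
      also have "\<dots> \<le> real n * (\<beta> - \<alpha>)" using n_ge assms by (intro mult_right_mono) auto
      finally show ?thesis .
    qed
    have n\<alpha>: "2 \<le> real n * (1 - 2 * \<alpha>)"
    proof -
      have "2 \<le> N_lo / \<epsilon> * (1 - 2 * \<alpha>)" using \<epsilon> \<epsilon>_le(4) by (simp add: field_simps)
      also have "\<dots> \<le> real n * (1 - 2 * \<alpha>)" using n_ge assms by (intro mult_right_mono) auto
      finally show ?thesis .
    qed
    have n_pos: "0 < n" using N3 nN by linarith
    \<comment> \<open>The least weight that the lower limit \<alpha> n admits. Rounding costs less
      than 1, which \<open>n\<beta>\<close> and \<open>n\<alpha>\<close> absorb.\<close>
    define w where "w = nat \<lceil>\<alpha> * real n\<rceil>"
    have "0 < \<alpha> * real n" using assms n_pos by simp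
    then have w_bounds: "\<alpha> * real n \<le> real w" "real w < \<alpha> * real n + 1" and w: "0 < w"
      unfolding w_def by linarith+
    have w\<beta>: "real w \<le> \<beta> * real n" using w_bounds n\<beta> by (simp add: algebra_simps)
    have wn: "2 * w \<le> n" using w_bounds n\<alpha> by (simp add: algebra_simps)
    have lin: "mesh_system D n T" if "T \<in> admissible_bits \<alpha> \<beta> D n" for T
    proof
      fix j assume "j < indep_size D"
      then have "\<alpha> * real n \<le> real (hamming_weight n (T j))"
        using that by (auto simp: admissible_bits_def)
      then show "0 < hamming_weight n (T j)" using \<open>0 < \<alpha> * real n\<close> by linarith
    qed (use D N3 n_pos in auto)
    have adm: "T \<in> admissible_bits \<alpha> \<beta> D n" if "\<And>j. hamming_weight n (T j) = w" for T
      using that w_bounds w\<beta> by (simp add: admissible_bits_def)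
    have base: "disjoint_bits w \<in> admissible_bits \<alpha> \<beta> D n"
      by (intro adm hamming_weight_disjoint_bits wn)
    have planted: "planted_bits w z \<in> admissible_bits \<alpha> \<beta> D n" if "z \<in> {1..<indep_size D} \<times> {..<w}" for z
      using that by (intro adm hamming_weight_planted_bits wn) auto
    have bound: "c * ((1 / \<epsilon>) ^ (2 * d) / (real d * ln (1 / \<epsilon>))) \<le> real (indep_size D - 1) * real w / 2"
    proof -
      have "3 \<le> 1 / \<epsilon>" using \<epsilon> \<epsilon>_le(1) by (simp add: field_simps)
      then have "exp 1 \<le> 1 / \<epsilon>" using exp_le by linarith
      then have "1 \<le> ln (1 / \<epsilon>)" using \<epsilon> by (subst ln_ge_iff) auto
      \<comment> \<open>The denominator is at least 1, so it suffices to prove the stronger bound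
        \<open>c * X\<^sup>2\<close>.\<close>
      then have "1 * 1 \<le> real d * ln (1 / \<epsilon>)" using d by (intro mult_mono) auto
      then have "(1 / \<epsilon>) ^ (2 * d) / (real d * ln (1 / \<epsilon>)) \<le> (1 / \<epsilon>) ^ (2 * d) / 1"
        using \<epsilon> by (intro divide_left_mono) auto
      also have "\<dots> = X\<^sup>2" by (simp add: X_def power_mult mult.commute)
      finally have "c * ((1 / \<epsilon>) ^ (2 * d) / (real d * ln (1 / \<epsilon>))) \<le> c * X\<^sup>2"
        using c by (intro mult_left_mono) auto
      also have "\<dots> = 200 * \<alpha> * (N_lo * X)\<^sup>2" by (simp add: c_def power_mult_distrib)
      also have "\<dots> \<le> 200 * \<alpha> * (2 * real k)\<^sup>2"
      proof (intro mult_left_mono power_mono)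
        show "N_lo * X \<le> 2 * real k" using N_X half by linarith
        show "0 \<le> N_lo * X" using assms \<epsilon> by (simp add: X_def)
      qed (use assms in auto)
      also have "\<dots> = (real k / 2) * (\<alpha> * (3200 * real k)) / 2"
        by (simp add: power2_eq_square)
      also have "\<dots> \<le> real (k - 1) * real w / 2"
      proof (intro divide_right_mono mult_mono)
        show "real k / 2 \<le> real (k - 1)" using k2 by (simp add: of_nat_diff)
        have "\<alpha> * (3200 * real k) \<le> \<alpha> * real n"
          using n assms by (intro mult_left_mono) (auto simp: k_def)
        then show "\<alpha> * (3200 * real k) \<le> real w" using w_bounds by linarith
      qed (use assms in auto)
      finally show ?thesis by (simp add: k_def)
    qed
    show ?thesis
    proof (intro conjI ballI allI impI)
      fix T assume T: "T \<in> admissible_bits \<alpha> \<beta> D n"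
      show "A_mat D *\<^sub>v u_star D n T = f_vec D n T"
        by (rule mesh_system.A_u_star[OF lin[OF T]])
      show "A_mat D *\<^sub>v u = f_vec D n T \<longleftrightarrow> least_squares_solution D n T u"
        if "u \<in> carrier_vec (num_nodes D)" for u
        by (rule mesh_system.A_mult_eq_f_iff[OF lin[OF T] that])
    next
      fix alg assume alg: "\<forall>T\<in>admissible_bits \<alpha> \<beta> D n. solves_system alg D n T"
      have "ennreal (c * ((1 / \<epsilon>) ^ (2 * space_dim D) / (real (space_dim D) * ln (1 / \<epsilon>)))) \<le>
          ennreal (real (indep_size D - 1) * real w / 2)"
        using bound unfolding d_def by (rule ennreal_leI)
      also have "\<dots> \<le> expected_calls (system_access D n (disjoint_bits w)) alg"
        using N3 w wn alg base planted by (intro expected_calls_disjoint_bits D) auto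
      finally show "\<exists>T\<in>admissible_bits \<alpha> \<beta> D n.
          ennreal (c * ((1 / \<epsilon>) ^ (2 * space_dim D) / (real (space_dim D) * ln (1 / \<epsilon>))))
            \<le> expected_calls (system_access D n T) alg"
        using base by blast
    qed
  qed
  show ?thesis
    by (rule exI[of _ c], rule conjI[OF c], rule exI[of _ \<epsilon>\<^sub>0], rule conjI[OF \<epsilon>\<^sub>0],
      intro allI, rule impI, rule main) (elim conjE, assumption)+
qed

end
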